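(* Let $\mathbb{K}$ be a field. Suppose that $G=(\mathcal{V},\mathcal{E})$ is a connected simple graph with a fat nexus, let $V=\mathbb{K}^{\mathcal{E}}$, and let $V=V_1\oplus V_2\oplus V_3$ be a decomposition associated with the fat nexus as described in the context. Let $\mathbb{G}_m$ act linearly through the characters $0,1,2$ on the direct summands $V_1,V_2,V_3$, respectively (that is, $t\in\mathbb{G}_m$ acts on $V_1,V_2,V_3$ by multiplication by $t^0,t^1,t^2$). Then this action descends to the projective graph hypersurface $X_G\subseteq\mathbb{P}V$ (that is, the induced action on $\mathbb{P}V$ restricts to an action on $X_G$), with fixed point scheme \[ X_G^{\mathbb{G}_m}=\mathbb{P}V_1\sqcup\mathbb{P}V_2\sqcup\mathbb{P}V_3. \]
   Context: All schemes are over $\mathbb{K}$. $\mathbb{P}V$ is the projective space of lines in $V$, and $\mathbb{K}[V]=\mathrm{Sym}\,V^\vee$ its coordinate ring. Graph hypersurface: let $x_e=e^\vee$, $e\in\mathcal{E}$, be the coordinates on $V=\mathbb{K}^{\mathcal{E}}$. For a connected graph $G$, $\psi_G=\sum_T\prod_{e\in T}x_e$, where $T$ runs over the edge sets of spanning trees of $G$, and $X_G=V(\psi_G)\subseteq\mathbb{P}V$. Fat nexus: let $v_0\in\mathcal{V}$ be a vertex with neighborhood $\mathcal{V}_0:=\{v_0\}\cup\{v\in\mathcal{V}\mid\{v,v_0\}\in\mathcal{E}\}$. $G$ is called a cone with apex $v_0$ if $\mathcal{V}_0=\mathcal{V}$. For $\mathcal{U}\subseteq\mathcal{V}$ set $\mathcal{U}^0:=\mathcal{U}\setminus\mathcal{V}_0$.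 Then $v_0$ is a fat nexus in $G$ if there is a partition $\mathcal{V}=\{v_0\}\sqcup\mathcal{V}_1\sqcup\mathcal{V}_2$ such that: (a) $\mathcal{V}_1\neq\emptyset$ and $\mathcal{V}_2\ne\emptyset$; (b) all edges between $\mathcal{V}_1$ and $\mathcal{V}_2$ have both vertices in $\mathcal{V}_0$, in other words, there are no edges between $\mathcal{V}_i^0$ and $\mathcal{V}_j$ for $\{i,j\}=\{1,2\}$; (c) if $G$ is a cone with apex $v_0$, then $|\mathcal{V}_1|\neq|\mathcal{V}_2|$. Decomposition of $V$: fix a fat nexus $v_0$ and a partition $\mathcal{V}=\{v_0\}\sqcup\mathcal{V}_1\sqcup\mathcal{V}_2$ satisfying (a)–(c). Pick an orientation of the edges and identify each $v\in\mathcal{V}$ with its incidence vector $v=(v_e)_{e\in\mathcal{E}}\in\{-1,0,1\}^{\mathcal{E}}\subseteq V$, where $v_e=-1$ or $v_e=1$ if $v$ is respectively the source or target of the non-loop edge $e$, and $v_e=0$ otherwise. Let $W:=\langle\mathcal{V}\rangle$ and $W_i:=\langle\mathcal{V}_i\rangle$, $i=1,2$, be the $\mathbb{K}$-spans in $V$. The Hadamard product of $w,w'\in V$ is $w\star w':=\sum_{e\in\mathcal{E}}w_ew'_e\cdot e$; for subspaces $A,B\subseteq V$, $A\star B$ denotes the span of all $a\star b$ with $a\in A$, $b\in B$. Let $q\colon V\to V^\vee$ be the isomorphism $\sum_e w_e\cdot e\mapsto\sum_e w_e\cdot x_e$. One has a direct sum decomposition \[ q(W\star W)=q(W_1\star W_1)\oplus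 q(W_1\star W_2)\oplus q(W_2\star W_2)\subseteq V^\vee. \] Enlarge one of the three direct summands by a complement of $q(W\star W)$ in $V^\vee$ to obtain a decomposition $V^\vee=U_1\oplus U_2\oplus U_3$ with $q(W_1\star W_1)\subseteq U_1$, $q(W_1\star W_2)\subseteq U_2$, $q(W_2\star W_2)\subseteq U_3$. Then $V=V_1\oplus V_2\oplus V_3$ is the (unique) dual decomposition with respect to the canonical pairing $V^\vee\times V\to\mathbb{K}$, that is, $V_i$ is the annihilator of $\bigoplus_{j\neq i}U_j$. *)

theory Defs
  imports
    "HOL-Analysis.Analysis"
    "HOL-Library.Function_Algebras"
    "HOL-Library.Set_Algebras"
    "HOL-Library.Poly_Mapping"
begin

section \<open>Graphs\<close>

text \<open>
  A graph has a vertex set \<open>Vs\<close> and the elements of a finite type \<open>'e\<close> as its edges; \<open>ends e\<close> is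
  the set of end vertices of the edge \<open>e\<close>. Hence \<open>'k ^ 'e\<close> is the vector space with basis the edges.
\<close>

definition simple_graph :: "'v set \<Rightarrow> ('e::finite \<Rightarrow> 'v set) \<Rightarrow> bool" where
  "simple_graph Vs ends \<longleftrightarrow>
     finite Vs \<and> (\<forall>e. ends e \<subseteq> Vs \<and> card (ends e) = 2) \<and> inj ends"

definition connected_by :: "'v set \<Rightarrow> ('e \<Rightarrow> 'v set) \<Rightarrow> 'e set \<Rightarrow> bool" where
  "connected_by Vs ends T \<longleftrightarrow>
     Vs \<noteq> {} \<and> (\<forall>u\<in>Vs. \<forall>v\<in>Vs. (u, v) \<in> {(x, y). \<exists>e\<in>T. ends e = {x, y}}\<^sup>*)"

definition connected_graph :: "'v set \<Rightarrow> ('e \<Rightarrow> 'v set) \<Rightarrow> bool" where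
  "connected_graph Vs ends \<longleftrightarrow> connected_by Vs ends UNIV"

text \<open>For simple graphs only: cycles of length 1 and 2 are not considered.\<close>

definition is_cycle :: "('e \<Rightarrow> 'v set) \<Rightarrow> 'e set \<Rightarrow> 'v list \<Rightarrow> bool" where
  "is_cycle ends T vs \<longleftrightarrow>
     length vs \<ge> 3 \<and> distinct vs \<and>
     (\<forall>i<length vs. \<exists>e\<in>T. ends e = {vs ! i, vs ! (Suc i mod length vs)})"

definition spanning_trees :: "'v set \<Rightarrow> ('e \<Rightarrow> 'v set) \<Rightarrow> 'e set set" where
  "spanning_trees Vs ends = {T. connected_by Vs ends T \<and> \<not> (\<exists>vs. is_cycle ends T vs)}"

definition nbhd :: "'v set \<Rightarrow> ('e \<Rightarrow> 'v set) \<Rightarrow> 'v \<Rightarrow> 'v set" where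
  "nbhd Vs ends v\<^sub>0 = {v\<^sub>0} \<union> {v\<in>Vs. \<exists>e. ends e = {v, v\<^sub>0}}"

definition is_cone :: "'v set \<Rightarrow> ('e \<Rightarrow> 'v set) \<Rightarrow> 'v \<Rightarrow> bool" where
  "is_cone Vs ends v\<^sub>0 \<longleftrightarrow> nbhd Vs ends v\<^sub>0 = Vs"

definition fat_nexus_partition ::
    "'v set \<Rightarrow> ('e \<Rightarrow> 'v set) \<Rightarrow> 'v \<Rightarrow> 'v set \<Rightarrow> 'v set \<Rightarrow> bool" where
  "fat_nexus_partition Vs ends v\<^sub>0 N\<^sub>1 N\<^sub>2 \<longleftrightarrow>
     Vs = {v\<^sub>0} \<union> N\<^sub>1 \<union> N\<^sub>2 \<and> v\<^sub>0 \<notin> N\<^sub>1 \<and> v\<^sub>0 \<notin> N\<^sub>2 \<and> N\<^sub>1 \<inter> N\<^sub>2 = {} \<and>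
     N\<^sub>1 \<noteq> {} \<and> N\<^sub>2 \<noteq> {} \<and>
     (\<forall>e. ends e \<inter> N\<^sub>1 \<noteq> {} \<and> ends e \<inter> N\<^sub>2 \<noteq> {} \<longrightarrow> ends e \<subseteq> nbhd Vs ends v\<^sub>0) \<and>
     (is_cone Vs ends v\<^sub>0 \<longrightarrow> card N\<^sub>1 \<noteq> card N\<^sub>2)"

definition orientation :: "('e \<Rightarrow> 'v set) \<Rightarrow> ('e \<Rightarrow> 'v) \<Rightarrow> ('e \<Rightarrow> 'v) \<Rightarrow> bool" where
  "orientation ends src tgt \<longleftrightarrow> (\<forall>e. ends e = {src e, tgt e})"


section \<open>The graph polynomial\<close>

text \<open>The coordinate ring of \<open>'k ^ 'e\<close> is the polynomial ring \<open>('e \<Rightarrow>\<^sub>0 nat) \<Rightarrow>\<^sub>0 'k\<close>.\<close>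

definition coord :: "'e \<Rightarrow> ('e \<Rightarrow>\<^sub>0 nat) \<Rightarrow>\<^sub>0 'k::field" where
  "coord e = Poly_Mapping.single (Poly_Mapping.single e 1) 1"

definition graph_polynomial ::
    "'v set \<Rightarrow> ('e::finite \<Rightarrow> 'v set) \<Rightarrow> ('e \<Rightarrow>\<^sub>0 nat) \<Rightarrow>\<^sub>0 'k::field" where
  "graph_polynomial Vs ends = (\<Sum>T\<in>spanning_trees Vs ends. \<Prod>e\<in>T. coord e)"


section \<open>The decomposition associated with a fat nexus\<close>

definition direct_complement ::
    "('r::comm_ring_1 \<Rightarrow> 'm::ab_group_add \<Rightarrow> 'm) \<Rightarrow> 'm set \<Rightarrow> 'm set \<Rightarrow> 'm set \<Rightarrow> bool" where
  "direct_complement smul M P Q \<longleftrightarrow>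
     module.subspace smul P \<and> module.subspace smul Q \<and> P + Q = M \<and> P \<inter> Q = {0}"

definition incidence :: "('e \<Rightarrow> 'v) \<Rightarrow> ('e \<Rightarrow> 'v) \<Rightarrow> 'v \<Rightarrow> 'k::field ^ 'e::finite" where
  "incidence src tgt v = (\<chi> e. if src e = v then - 1 else if tgt e = v then 1 else 0)"

definition hadamard :: "'k::field ^ 'e::finite \<Rightarrow> 'k ^ 'e \<Rightarrow> 'k ^ 'e" where
  "hadamard w w' = (\<chi> e. w $ e * w' $ e)"

definition hadamard_span :: "('k::field ^ 'e::finite) set \<Rightarrow> ('k ^ 'e) set \<Rightarrow> ('k ^ 'e) set" where
  "hadamard_span A B = vec.span {hadamard a b | a b. a \<in> A \<and> b \<in> B}"

definition dual_space :: "('k::field ^ 'e::finite \<Rightarrow> 'k) set" where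
  "dual_space = {f. Vector_Spaces.linear (*s) (*) f}"

definition dual_scale :: "'k::field \<Rightarrow> ('k ^ 'e::finite \<Rightarrow> 'k) \<Rightarrow> ('k ^ 'e \<Rightarrow> 'k)" where
  "dual_scale c f = (\<lambda>v. c * f v)"

definition to_dual :: "'k::field ^ 'e::finite \<Rightarrow> ('k ^ 'e \<Rightarrow> 'k)" where
  "to_dual w = (\<lambda>v. \<Sum>e\<in>UNIV. w $ e * v $ e)"

definition annihilator :: "('k::field ^ 'e::finite \<Rightarrow> 'k) set \<Rightarrow> ('k ^ 'e) set" where
  "annihilator U = {v. \<forall>f\<in>U. f v = 0}"

text \<open>
  \<open>U + C\<close> is the sum of subspaces (elementwise addition of sets). The three alternatives say which of
  the three summands of \<open>q(W \<star> W)\<close> is enlarged by the complement \<open>C\<close>. That the sums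
  of the \<open>U\<^sub>i\<close> and of the \<open>V\<^sub>i\<close> are direct is a consequence for a fat nexus, not a requirement.
\<close>

definition nexus_decomposition ::
    "('e::finite \<Rightarrow> 'v) \<Rightarrow> ('e \<Rightarrow> 'v) \<Rightarrow> 'v set \<Rightarrow> 'v set \<Rightarrow> 'v set \<Rightarrow>
     ('k::field ^ 'e) set \<Rightarrow> ('k ^ 'e) set \<Rightarrow> ('k ^ 'e) set \<Rightarrow> bool" where
  "nexus_decomposition src tgt Vs N\<^sub>1 N\<^sub>2 V\<^sub>1 V\<^sub>2 V\<^sub>3 \<longleftrightarrow>
     (let W = vec.span (incidence src tgt ` Vs);
          W\<^sub>1 = vec.span (incidence src tgt ` N\<^sub>1);
          W\<^sub>2 = vec.span (incidence src tgt ` N\<^sub>2);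
          Q = to_dual ` hadamard_span W W;
          Q\<^sub>1 = to_dual ` hadamard_span W\<^sub>1 W\<^sub>1;
          Q\<^sub>2 = to_dual ` hadamard_span W\<^sub>1 W\<^sub>2;
          Q\<^sub>3 = to_dual ` hadamard_span W\<^sub>2 W\<^sub>2
      in \<exists>C U\<^sub>1 U\<^sub>2 U\<^sub>3.
           direct_complement dual_scale dual_space Q C \<and>
           (U\<^sub>1 = Q\<^sub>1 + C \<and> U\<^sub>2 = Q\<^sub>2 \<and> U\<^sub>3 = Q\<^sub>3 \<or>
            U\<^sub>1 = Q\<^sub>1 \<and> U\<^sub>2 = Q\<^sub>2 + C \<and> U\<^sub>3 = Q\<^sub>3 \<or>
            U\<^sub>1 = Q\<^sub>1 \<and> U\<^sub>2 = Q\<^sub>2 \<and> U\<^sub>3 = Q\<^sub>3 + C) \<and>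
           V\<^sub>1 = annihilator (U\<^sub>2 + U\<^sub>3) \<and>
           V\<^sub>2 = annihilator (U\<^sub>1 + U\<^sub>3) \<and>
           V\<^sub>3 = annihilator (U\<^sub>1 + U\<^sub>2))"


section \<open>Projective schemes by their functors of points\<close>

text \<open>
  A scheme over the field \<open>'k\<close> is represented by its functor of points on commutative
  \<open>'k\<close>-algebras. An algebra is a type \<open>'r\<close> with its structure map \<open>\<iota> :: 'k \<Rightarrow> 'r\<close>; a statement with
  free \<open>'r\<close> and \<open>\<iota>\<close> is a statement for all algebras. (The class \<open>comm_ring_1\<close> excludes the
  zero algebra. Nothing is lost: the zero algebra carries no information on a Zariski sheaf.)
  All schemes below are subschemes of the projective space of lines in \<open>'k ^ 'e\<close>, so that an
  \<open>'r\<close>-point is a submodule of \<open>'r ^ 'e\<close>, and equality of subschemes is equality of the sets of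
  \<open>'r\<close>-points for all \<open>'r\<close>.
\<close>

definition ring_map :: "('r::comm_ring_1 \<Rightarrow> 's::comm_ring_1) \<Rightarrow> bool" where
  "ring_map \<phi> \<longleftrightarrow>
     \<phi> 1 = 1 \<and> (\<forall>x y. \<phi> (x + y) = \<phi> x + \<phi> y) \<and> (\<forall>x y. \<phi> (x * y) = \<phi> x * \<phi> y)"

text \<open>
  For a direct summand \<open>A\<close> of \<open>'r ^ 'e\<close> this is the tensor product of \<open>A\<close> with \<open>'s\<close>, seen as a direct
  summand of \<open>'s ^ 'e\<close>.
\<close>

definition base_change ::
    "('r::comm_ring_1 \<Rightarrow> 's::comm_ring_1) \<Rightarrow> ('r ^ 'e::finite) set \<Rightarrow> ('s ^ 'e) set" where
  "base_change \<phi> A = module.span (*s) ((\<lambda>v. \<chi> e. \<phi> (v $ e)) ` A)"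

text \<open>
  The localization of \<open>L\<close> at the powers of \<open>s\<close> is free with basis the image of one element \<open>l\<close> of \<open>L\<close>,
  with the fractions written out. Allowing as a basis \<open>l / s ^ k\<close> gives the same notion.
\<close>

definition free_rank_one_away :: "'r::comm_ring_1 \<Rightarrow> ('r ^ 'e::finite) set \<Rightarrow> bool" where
  "free_rank_one_away s L \<longleftrightarrow>
     (\<exists>l\<in>L. (\<forall>x\<in>L. \<exists>n r. s ^ n *s x = r *s l) \<and> (\<forall>r. r *s l = 0 \<longrightarrow> (\<exists>n. s ^ n * r = 0)))"

text \<open>Free of rank one on the members of a cover of the spectrum by basic open sets.\<close>

definition locally_free_rank_one :: "('r::comm_ring_1 ^ 'e::finite) set \<Rightarrow> bool" where
  "locally_free_rank_one L \<longleftrightarrow>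
     (\<exists>F c. finite F \<and> (\<Sum>s\<in>F. c s * s) = 1 \<and> (\<forall>s\<in>F. free_rank_one_away s L))"

text \<open>The \<open>'r\<close>-points of the projective space of lines in \<open>M\<close>: direct summands of rank one.\<close>

definition proj_points :: "('r::comm_ring_1 ^ 'e::finite) set \<Rightarrow> ('r ^ 'e) set set" where
  "proj_points M = {L. (\<exists>N. direct_complement (*s) M L N) \<and> locally_free_rank_one L}"

definition proj_subspace ::
    "('k::field \<Rightarrow> 'r::comm_ring_1) \<Rightarrow> ('k ^ 'e::finite) set \<Rightarrow> ('r ^ 'e) set set" where
  "proj_subspace \<iota> A = proj_points (base_change \<iota> A)"

definition eval_poly ::
    "('k::field \<Rightarrow> 'r::comm_ring_1) \<Rightarrow> (('e \<Rightarrow>\<^sub>0 nat) \<Rightarrow>\<^sub>0 'k) \<Rightarrow> 'r ^ 'e::finite \<Rightarrow> 'r" where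
  "eval_poly \<iota> p v =
     (\<Sum>m\<in>Poly_Mapping.keys p. \<iota> (Poly_Mapping.lookup p m) * (\<Prod>e\<in>UNIV. v $ e ^ Poly_Mapping.lookup m e))"

text \<open>
  The zero locus of a homogeneous polynomial: a line \<open>L\<close> belongs to it if the restriction of \<open>p\<close> to \<open>L\<close>,
  a section of a tensor power of the dual of \<open>L\<close>, vanishes. By homogeneity this can be tested on
  the elements of \<open>L\<close>.
\<close>

definition proj_zero_locus ::
    "('k::field \<Rightarrow> 'r::comm_ring_1) \<Rightarrow> (('e \<Rightarrow>\<^sub>0 nat) \<Rightarrow>\<^sub>0 'k) \<Rightarrow> ('r ^ 'e::finite) set set" where
  "proj_zero_locus \<iota> p = {L \<in> proj_points UNIV. \<forall>x\<in>L. eval_poly \<iota> p x = 0}"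

definition graph_hypersurface ::
    "'v set \<Rightarrow> ('e \<Rightarrow> 'v set) \<Rightarrow> ('k::field \<Rightarrow> 'r::comm_ring_1) \<Rightarrow> ('r ^ 'e::finite) set set" where
  "graph_hypersurface Vs ends \<iota> = proj_zero_locus \<iota> (graph_polynomial Vs ends)"

text \<open>
  Three subschemes with \<open>'r\<close>-points \<open>proj_subspace \<iota> A\<^sub>i\<close>. An \<open>'r\<close>-point of their disjoint union is
  a decomposition of the spectrum into three open and closed parts, given by orthogonal
  idempotents \<open>a\<^sub>i\<close>, with a point of the \<open>i\<close>-th subscheme over the \<open>i\<close>-th part, whose coordinate ring
  is \<open>a\<^sub>i * 'r\<close>. For a line \<open>L\<close> the last condition is that the restriction \<open>a\<^sub>i * L\<close> of \<open>L\<close> to that part is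
  contained in the base change of \<open>A\<^sub>i\<close>. Disjointness is a separate condition.
\<close>

definition proj_union ::
    "('k::field \<Rightarrow> 'r::comm_ring_1) \<Rightarrow> ('k ^ 'e::finite) set \<Rightarrow> ('k ^ 'e) set \<Rightarrow> ('k ^ 'e) set \<Rightarrow>
     ('r ^ 'e) set set" where
  "proj_union \<iota> A\<^sub>1 A\<^sub>2 A\<^sub>3 =
     {L \<in> proj_points UNIV. \<exists>a\<^sub>1 a\<^sub>2 a\<^sub>3.
        a\<^sub>1 + a\<^sub>2 + a\<^sub>3 = 1 \<and> a\<^sub>1 * a\<^sub>2 = 0 \<and> a\<^sub>1 * a\<^sub>3 = 0 \<and> a\<^sub>2 * a\<^sub>3 = 0 \<and>
        (\<forall>x\<in>L. a\<^sub>1 *s x \<in> base_change \<iota> A\<^sub>1 \<and> a\<^sub>2 *s x \<in> base_change \<iota> A\<^sub>2 \<and>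
               a\<^sub>3 *s x \<in> base_change \<iota> A\<^sub>3)}"

definition proj_disjoint ::
    "('k::field \<Rightarrow> 'r::comm_ring_1) \<Rightarrow> ('k ^ 'e::finite) set \<Rightarrow> ('k ^ 'e) set \<Rightarrow> ('k ^ 'e) set \<Rightarrow> bool" where
  "proj_disjoint \<iota> A\<^sub>1 A\<^sub>2 A\<^sub>3 \<longleftrightarrow>
     proj_subspace \<iota> A\<^sub>1 \<inter> proj_subspace \<iota> A\<^sub>2 = {} \<and>
     proj_subspace \<iota> A\<^sub>1 \<inter> proj_subspace \<iota> A\<^sub>3 = {} \<and>
     proj_subspace \<iota> A\<^sub>2 \<inter> proj_subspace \<iota> A\<^sub>3 = {}"


section \<open>The torus action\<close>

text \<open>The image of \<open>L\<close> under multiplication by \<open>1\<close>, \<open>t\<close>, \<open>t\<^sup>2\<close> on the base changes of \<open>V\<^sub>1\<close>, \<open>V\<^sub>2\<close>, \<open>V\<^sub>3\<close>.\<close>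

definition gm_act ::
    "('k::field \<Rightarrow> 'r::comm_ring_1) \<Rightarrow> ('k ^ 'e::finite) set \<Rightarrow> ('k ^ 'e) set \<Rightarrow> ('k ^ 'e) set \<Rightarrow>
     'r \<Rightarrow> ('r ^ 'e) set \<Rightarrow> ('r ^ 'e) set" where
  "gm_act \<iota> V\<^sub>1 V\<^sub>2 V\<^sub>3 t L =
     {v\<^sub>1 + t *s v\<^sub>2 + t ^ 2 *s v\<^sub>3 | v\<^sub>1 v\<^sub>2 v\<^sub>3.
        v\<^sub>1 \<in> base_change \<iota> V\<^sub>1 \<and> v\<^sub>2 \<in> base_change \<iota> V\<^sub>2 \<and> v\<^sub>3 \<in> base_change \<iota> V\<^sub>3 \<and> v\<^sub>1 + v\<^sub>2 + v\<^sub>3 \<in> L}"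

text \<open>The group of units of \<open>'r\<close>, which is the group of \<open>'r\<close>-points of the torus, acts on the set \<open>X\<close>.\<close>

definition gm_acts_on ::
    "('k::field \<Rightarrow> 'r::comm_ring_1) \<Rightarrow> ('k ^ 'e::finite) set \<Rightarrow> ('k ^ 'e) set \<Rightarrow> ('k ^ 'e) set \<Rightarrow>
     ('r ^ 'e) set set \<Rightarrow> bool" where
  "gm_acts_on \<iota> V\<^sub>1 V\<^sub>2 V\<^sub>3 X \<longleftrightarrow>
     (\<forall>t. t dvd 1 \<longrightarrow> (\<forall>L\<in>X. gm_act \<iota> V\<^sub>1 V\<^sub>2 V\<^sub>3 t L \<in> X)) \<and>
     (\<forall>L\<in>X. gm_act \<iota> V\<^sub>1 V\<^sub>2 V\<^sub>3 1 L = L) \<and>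
     (\<forall>s t. s dvd 1 \<longrightarrow> t dvd 1 \<longrightarrow> (\<forall>L\<in>X.
        gm_act \<iota> V\<^sub>1 V\<^sub>2 V\<^sub>3 (s * t) L = gm_act \<iota> V\<^sub>1 V\<^sub>2 V\<^sub>3 s (gm_act \<iota> V\<^sub>1 V\<^sub>2 V\<^sub>3 t L)))"

text \<open>Compatibility of the action with a homomorphism \<open>\<phi>\<close> of algebras.\<close>

definition gm_act_natural ::
    "('r::comm_ring_1 \<Rightarrow> 's::comm_ring_1) \<Rightarrow> ('k::field \<Rightarrow> 'r) \<Rightarrow>
     ('k ^ 'e::finite) set \<Rightarrow> ('k ^ 'e) set \<Rightarrow> ('k ^ 'e) set \<Rightarrow> ('r ^ 'e) set set \<Rightarrow> bool" where
  "gm_act_natural \<phi> \<iota> V\<^sub>1 V\<^sub>2 V\<^sub>3 X \<longleftrightarrow>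
     (\<forall>t. t dvd 1 \<longrightarrow> (\<forall>L\<in>X.
        base_change \<phi> (gm_act \<iota> V\<^sub>1 V\<^sub>2 V\<^sub>3 t L) =
        gm_act (\<phi> \<circ> \<iota>) V\<^sub>1 V\<^sub>2 V\<^sub>3 (\<phi> t) (base_change \<phi> L)))"

text \<open>
  The fixed point scheme represents the functor of equivariant morphisms from schemes with
  trivial action: an \<open>'r\<close>-point of \<open>X\<close> is fixed if the action morphism and the projection, composed
  with it, agree on the product of the torus and the spectrum of \<open>'r\<close>. This product is the spectrum
  of the ring \<open>int \<Rightarrow>\<^sub>0 'r\<close> of Laurent polynomials (the group ring of the integers), and the torus
  coordinate is the monomial of exponent 1. Equivalently, the point is fixed by all units of all
  \<open>'r\<close>-algebras.
\<close>

definition laurent_const :: "'r::comm_ring_1 \<Rightarrow> (int \<Rightarrow>\<^sub>0 'r)" where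
  "laurent_const r = Poly_Mapping.single 0 r"

definition laurent_var :: "int \<Rightarrow>\<^sub>0 'r::comm_ring_1" where
  "laurent_var = Poly_Mapping.single 1 1"

definition gm_fixed_points ::
    "('k::field \<Rightarrow> 'r::comm_ring_1) \<Rightarrow> ('k ^ 'e::finite) set \<Rightarrow> ('k ^ 'e) set \<Rightarrow> ('k ^ 'e) set \<Rightarrow>
     ('r ^ 'e) set set \<Rightarrow> ('r ^ 'e) set set" where
  "gm_fixed_points \<iota> V\<^sub>1 V\<^sub>2 V\<^sub>3 X =
     {L \<in> X. gm_act (laurent_const \<circ> \<iota>) V\<^sub>1 V\<^sub>2 V\<^sub>3 laurent_var (base_change laurent_const L) =
             base_change laurent_const L}"

end

theory Submission
  imports Defs "HOL-Library.Transitive_Closure_Table"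
begin

text \<open>
  Write \<open>S\<close> for \<open>N\<^sub>1 \<union> N\<^sub>2\<close>, that is, for all vertices except \<open>v\<^sub>0\<close>. By the matrix-tree theorem the
  graph polynomial at \<open>x\<close> is the determinant of the weighted Laplacian of \<open>x\<close> with rows and columns in
  \<open>S\<close>, and its entry at \<open>(i, j)\<close> is the linear form of the Hadamard product of the incidence vectors of
  \<open>i\<close> and \<open>j\<close>. Give the vertices in \<open>N\<^sub>1\<close> weight \<open>0\<close> and those in \<open>N\<^sub>2\<close> weight \<open>1\<close>. The decomposition
  is made so that the entry at \<open>(i, j)\<close> vanishes on the weight spaces of all weights other than
  \<open>d i + d j\<close>. Hence \<open>t\<close> multiplies this entry by \<open>t ^ (d i + d j)\<close> and the determinant by
  \<open>t ^ (2 * card N\<^sub>2)\<close>, so that the hypersurface is invariant.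

  A point of a linear representation of the torus is fixed if and only if it lies, locally on the
  base, in one of the weight spaces. Over a ring this is seen as follows. Comparing coefficients of
  Laurent polynomials shows that a fixed line \<open>L\<close> is stable under the projections onto the weight
  spaces (\<open>torus_fixed_line_iff\<close>). An endomorphism of a direct summand of rank one is multiplication
  by a scalar (\<open>endomorphism_of_line_is_scalar\<close>), and since \<open>L\<close> is faithful the three scalars are
  orthogonal idempotents of sum \<open>1\<close>.

  It remains to see that each weight space lies in the hypersurface. In the Leibniz expansion
  on the space of weight \<open>k\<close>, a permutation \<open>p\<close> contributes only if \<open>d i + d (p i) = k\<close> for all \<open>i\<close>. For
  \<open>k = 0\<close> and \<open>k = 2\<close> this is impossible because \<open>N\<^sub>2\<close> and \<open>N\<^sub>1\<close> are nonempty. For \<open>k = 1\<close> it says that \<open>p\<close>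
  exchanges \<open>N\<^sub>1\<close> and \<open>N\<^sub>2\<close>, which then have the same size; so \<open>v\<^sub>0\<close> is not the apex of a cone, and a
  vertex that is not adjacent to \<open>v\<^sub>0\<close> has no edge to the other side
  (\<open>nexus_permutation_zero\<close>). This is the only place where the cone condition enters.
\<close>

section \<open>Leibniz determinants over a finite index set\<close>

definition leibniz_det :: "'v set \<Rightarrow> ('v \<Rightarrow> 'v \<Rightarrow> 'r::comm_ring_1) \<Rightarrow> 'r" where
  "leibniz_det S M = (\<Sum>p | p permutes S. of_int (sign p) * (\<Prod>i\<in>S. M i (p i)))"

lemma leibniz_det_cong:
  assumes "\<And>i j. i \<in> S \<Longrightarrow> j \<in> S \<Longrightarrow> M i j = M' i j"
  shows "leibniz_det S M = leibniz_det S M'"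
  unfolding leibniz_det_def
  using assms by (intro sum.cong arg_cong2[where f="(*)"] prod.cong) (auto simp: permutes_in_image)

lemma leibniz_det_empty: "leibniz_det {} M = 1"
  by (simp add: leibniz_det_def sign_id)

text \<open>
  The permutations that pick the changed diagonal entry are those that fix \<open>i\<close>, and they are
  the permutations of the remaining indices.
\<close>

lemma leibniz_det_add_diagonal:
  assumes fin: "finite S" and i: "i \<in> S"
  shows "leibniz_det S (\<lambda>a b. M a b + (if a = i \<and> b = i then c else 0)) =
    leibniz_det S M + c * leibniz_det (S - {i}) M"
proof -
  let ?M = "\<lambda>a b. M a b + (if a = i \<and> b = i then c else 0)"
  let ?t = "\<lambda>p. of_int (sign p) * (\<Prod>j\<in>S - {i}. M j (p j))"
  have split: "(\<Prod>j\<in>S. ?M j (p j)) =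
      (\<Prod>j\<in>S. M j (p j)) + (if p i = i then c * (\<Prod>j\<in>S - {i}. M j (p j)) else 0)" for p
  proof -
    have "(\<Prod>j\<in>S - {i}. ?M j (p j)) = (\<Prod>j\<in>S - {i}. M j (p j))"
      by (intro prod.cong) auto
    then show ?thesis
      using fin i by (simp add: prod.remove[of S i] algebra_simps)
  qed
  have "leibniz_det S ?M =
      leibniz_det S M + (\<Sum>p | p permutes S. if p i = i then c * ?t p else 0)"
    unfolding leibniz_det_def split sum.distrib[symmetric]
    by (intro sum.cong) (auto simp: algebra_simps)
  also have "(\<Sum>p | p permutes S. if p i = i then c * ?t p else 0) =
      (\<Sum>p | p permutes (S - {i}). c * ?t p)"
  proof -
    have "{p. p permutes (S - {i})} = {p \<in> {p. p permutes S}. p i = i}"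
      by (auto intro: permutes_subset permutes_superset simp: permutes_not_in)
    then show ?thesis
      using fin by (simp only: sum.inter_filter finite_permutations)
  qed
  finally show ?thesis
    by (simp add: leibniz_det_def sum_distrib_left)
qed

text \<open>
  This is the expansion of a matrix whose row \<open>k\<close> has been replaced by row \<open>l\<close>. Composition with the
  transposition of \<open>k\<close> and \<open>l\<close> exchanges even and odd permutations, so that the terms cancel in pairs.
  Cancelling pairs, rather than deducing that the sum equals its own negative, also covers
  characteristic \<open>2\<close>.
\<close>

lemma leibniz_sum_identical_rows:
  assumes fin: "finite S" and k: "k \<in> S" and l: "l \<in> S" and "k \<noteq> l"
  shows "(\<Sum>p | p permutes S. of_int (sign p) * (M l (p k) * (\<Prod>i\<in>S - {k}. M i (p i)))) = (0::'r::comm_ring_1)"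
proof -
  let ?\<tau> = "Transposition.transpose k l"
  define g where "g p = of_int (sign p) * (M l (p k) * (\<Prod>i\<in>S - {k}. M i (p i)))" for p
  let ?E = "{p. p permutes S \<and> evenperm p}" and ?O = "{p. p permutes S \<and> \<not> evenperm p}"
  have finp: "finite {p. p permutes S}"
    using fin by (rule finite_permutations)
  have perm: "permutation p" if "p permutes S" for p
    using that fin by (auto simp: permutation_permutes)
  have \<tau>: "?\<tau> permutes S"
    using k l by (rule permutes_swap_id)
  have even: "evenperm (p \<circ> ?\<tau>) \<longleftrightarrow> \<not> evenperm p" if "p permutes S" for p
    using that perm \<open>k \<noteq> l\<close> by (simp add: evenperm_comp permutation_swap_id evenperm_swap)
  have g: "g (p \<circ> ?\<tau>) = - g p" if "p permutes S" for p
  proof -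
    have "sign (p \<circ> ?\<tau>) = - sign p"
      using even[OF that] by (simp add: sign_def)
    moreover have "M l ((p \<circ> ?\<tau>) k) * (\<Prod>i\<in>S - {k}. M i ((p \<circ> ?\<tau>) i)) = M l (p k) * (\<Prod>i\<in>S - {k}. M i (p i))"
    proof -
      have "(\<Prod>i\<in>S - {k} - {l}. M i ((p \<circ> ?\<tau>) i)) = (\<Prod>i\<in>S - {k} - {l}. M i (p i))"
        by (intro prod.cong) (auto simp: transpose_def)
      then show ?thesis
        using fin l \<open>k \<noteq> l\<close> by (simp add: prod.remove[of "S - {k}" l] algebra_simps)
    qed
    ultimately show ?thesis by (simp add: g_def)
  qed
  have "sum g ?O = (\<Sum>p\<in>?E. g (p \<circ> ?\<tau>))"
    by (rule sum.reindex_bij_witness[where i="\<lambda>p. p \<circ> ?\<tau>" and j="\<lambda>p. p \<circ> ?\<tau>"])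
      (use \<tau> even in \<open>auto simp: comp_assoc permutes_compose\<close>)
  also have "\<dots> = - sum g ?E"
    by (simp add: g sum_negf)
  finally have "sum g ?O + sum g ?E = 0" by simp
  moreover have "sum g {p. p permutes S} = sum g ?O + sum g ?E"
    using finp by (subst sum.union_disjoint[symmetric]) (auto intro!: sum.cong)
  ultimately show ?thesis by (simp add: g_def)
qed

text \<open>
  One row is minus the sum of the others.
\<close>

lemma leibniz_det_zero_column_sums:
  assumes fin: "finite S" and ne: "S \<noteq> {}" and zero: "\<And>j. j \<in> S \<Longrightarrow> (\<Sum>i\<in>S. M i j) = 0"
  shows "leibniz_det S M = 0"
proof -
  obtain k where k: "k \<in> S" using ne by auto
  have row: "M k j = - (\<Sum>l\<in>S - {k}. M l j)" if "j \<in> S" for j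
    using zero[OF that] fin k by (simp add: sum.remove[of S k] eq_neg_iff_add_eq_0)
  have "leibniz_det S M =
      (\<Sum>p | p permutes S. - (\<Sum>l\<in>S - {k}. of_int (sign p) * (M l (p k) * (\<Prod>i\<in>S - {k}. M i (p i)))))"
    unfolding leibniz_det_def
    using fin k by (intro sum.cong)
      (auto simp: prod.remove[of S k] row permutes_in_image sum_distrib_left sum_distrib_right mult.assoc)
  also have "\<dots> = - (\<Sum>l\<in>S - {k}. \<Sum>p | p permutes S. of_int (sign p) * (M l (p k) * (\<Prod>i\<in>S - {k}. M i (p i))))"
    by (subst sum.swap) (simp add: sum_negf)
  also have "\<dots> = 0"
  proof -
    have "(\<Sum>l\<in>S - {k}. \<Sum>p | p permutes S. of_int (sign p) * (M l (p k) * (\<Prod>i\<in>S - {k}. M i (p i)))) = 0"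
      using fin k by (intro sum.neutral ballI leibniz_sum_identical_rows) auto
    then show ?thesis by simp
  qed
  finally show ?thesis .
qed

section \<open>The matrix-tree theorem\<close>

text \<open>
  Every vertex of \<open>S\<close> is connected by \<open>T\<close> to the complement of \<open>S\<close>, phrased by cuts instead of paths:
  this form passes through contractions of edges without any surgery on paths.
\<close>

definition grounded :: "('e \<Rightarrow> 'v set) \<Rightarrow> 'v set \<Rightarrow> 'e set \<Rightarrow> bool" where
  "grounded ends S T \<longleftrightarrow>
     (\<forall>U. U \<subseteq> S \<longrightarrow> U \<noteq> {} \<longrightarrow> (\<exists>e\<in>T. \<exists>a\<in>U. \<exists>b. b \<notin> U \<and> ends e = {a, b}))"

text \<open>
  Removing \<open>i\<close> from \<open>S\<close> contracts the edge \<open>e\<close> into the complement of \<open>S\<close>. The edge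
  \<open>e\<close> leaves the subsets of \<open>S\<close> that contain \<open>i\<close> and no others.
\<close>

lemma grounded_contract:
  assumes e: "e \<in> T" and ends: "ends e = {i, r}" and "i \<in> S" and "r \<notin> S"
  shows "grounded ends S T \<longleftrightarrow> grounded ends (S - {i}) (T - {e})"
proof
  assume g: "grounded ends S T"
  show "grounded ends (S - {i}) (T - {e})"
    unfolding grounded_def
  proof (intro allI impI)
    fix U assume U: "U \<subseteq> S - {i}" "U \<noteq> {}"
    then obtain f a b where f: "f \<in> T" "a \<in> U" "b \<notin> U" "ends f = {a, b}"
      using g unfolding grounded_def by (metis Diff_subset subset_trans)
    then have "a \<in> ends f" "a \<notin> ends e" using U assms by auto
    then have "f \<noteq> e" by auto
    then show "\<exists>e\<in>T - {e}. \<exists>a\<in>U. \<exists>b. b \<notin> U \<and> ends e = {a, b}" using f by blast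
  qed
next
  assume g: "grounded ends (S - {i}) (T - {e})"
  show "grounded ends S T"
    unfolding grounded_def
  proof (intro allI impI)
    fix U assume U: "U \<subseteq> S" "U \<noteq> {}"
    show "\<exists>e\<in>T. \<exists>a\<in>U. \<exists>b. b \<notin> U \<and> ends e = {a, b}"
    proof (cases "i \<in> U")
      case True
      then show ?thesis using e ends \<open>r \<notin> S\<close> U by blast
    next
      case False
      then have "U \<subseteq> S - {i}" using U by auto
      then show ?thesis using g U unfolding grounded_def by (metis Diff_iff)
    qed
  qed
qed

lemma grounded_mono: "grounded ends S T \<Longrightarrow> T \<subseteq> T' \<Longrightarrow> grounded ends S T'"
  unfolding grounded_def by (meson subsetD)

text \<open>
  Contracting one edge after the other into the complement of \<open>S\<close> uses exactly one edge for
  each vertex of \<open>S\<close>.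
\<close>

lemma grounded_thin:
  assumes "finite S" and "finite T" and "grounded ends S T"
  shows "\<exists>T'\<subseteq>T. grounded ends S T' \<and> card T' = card S"
  using assms
proof (induction "card S" arbitrary: S T)
  case 0
  then show ?case by (intro exI[of _ "{}"]) (auto simp: grounded_def)
next
  case (Suc n)
  then have "S \<noteq> {}" by auto
  with Suc.prems(3) obtain e i r where e: "e \<in> T" "i \<in> S" "r \<notin> S" "ends e = {i, r}"
    unfolding grounded_def by blast
  then have "grounded ends (S - {i}) (T - {e})"
    using grounded_contract[of e T ends i r S] e Suc.prems(3) by simp
  then obtain T' where T': "T' \<subseteq> T - {e}" "grounded ends (S - {i}) T'" "card T' = card (S - {i})"
    using Suc.hyps(1)[of "S - {i}" "T - {e}"] Suc.hyps(2)[symmetric] Suc.prems e by auto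
  have "insert e T' - {e} = T'" using T' by auto
  then have "grounded ends S (insert e T')"
    using T' e grounded_contract[of e "insert e T'" ends i r S] by simp
  moreover have "card (insert e T') = card S"
  proof -
    have "finite T'" "e \<notin> T'" using T' Suc.prems by (auto intro: finite_subset)
    then show ?thesis using T' Suc.hyps(2)[symmetric] Suc.prems(1) e by simp
  qed
  ultimately show ?case using T' e by (intro exI[of _ "insert e T'"]) auto
qed

text \<open>
  Both conditions single out, among the grounded sets, the spanning forests rooted outside
  \<open>S\<close>. The induction for the matrix-tree theorem needs the count of edges, while minimality is what absence of cycles means.
\<close>

lemma grounded_card_iff_minimal:
  assumes "finite S" and "finite T" and g: "grounded ends S T"
  shows "card T = card S \<longleftrightarrow> (\<forall>e\<in>T. \<not> grounded ends S (T - {e}))"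
proof
  assume c: "card T = card S"
  show "\<forall>e\<in>T. \<not> grounded ends S (T - {e})"
  proof (intro ballI notI)
    fix e assume e: "e \<in> T" "grounded ends S (T - {e})"
    then obtain T' where "T' \<subseteq> T - {e}" "card T' = card S"
      using grounded_thin[of S "T - {e}" ends] assms by auto
    then have "card S \<le> card (T - {e})" using assms by (metis card_mono finite_Diff)
    moreover have "card (T - {e}) < card T" using e assms by (intro card_Diff1_less)
    ultimately show False using c by simp
  qed
next
  assume m: "\<forall>e\<in>T. \<not> grounded ends S (T - {e})"
  obtain T' where T': "T' \<subseteq> T" "grounded ends S T'" "card T' = card S"
    using grounded_thin[OF assms] by auto
  have "T' = T"
  proof (rule ccontr)
    assume "T' \<noteq> T"
    then obtain e where "e \<in> T" "e \<notin> T'" using T' by auto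
    then have "T' \<subseteq> T - {e}" using T' by auto
    with T'(2) m \<open>e \<in> T\<close> show False using grounded_mono by blast
  qed
  then show "card T = card S" using T' by simp
qed

text \<open>
  The matrix of the quadratic form \<open>\<Sum>e\<in>A. x e * (f u - f v)\<^sup>2\<close>, where \<open>u\<close> and \<open>v\<close> are the ends of \<open>e\<close>. It is
  written without signs of orientations, so that it makes sense for weights in any ring; only the
  edges in \<open>A\<close> are taken into account so that edges can be deleted.
\<close>

definition laplacian ::
    "('e \<Rightarrow> 'v set) \<Rightarrow> 'e set \<Rightarrow> ('e \<Rightarrow> 'r::comm_ring_1) \<Rightarrow> 'v \<Rightarrow> 'v \<Rightarrow> 'r" where
  "laplacian ends A x i j =
     (\<Sum>e\<in>A. (if i = j then if i \<in> ends e then 1 else 0 else if ends e = {i, j} then - 1 else 0) * x e)"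

text \<open>
  Deletion and contraction: if an edge \<open>e\<close> joins \<open>i\<close> in \<open>S\<close> to a vertex outside \<open>S\<close>, then \<open>x e\<close> occurs in
  the diagonal entry at \<open>i\<close> only. Expanding the determinant along it corresponds to distinguishing
  whether a forest contains \<open>e\<close>. If no edge leaves \<open>S\<close>, then all columns add up to zero and there is no
  forest.
\<close>

lemma matrix_tree:
  fixes x :: "'e \<Rightarrow> 'r::comm_ring_1"
  assumes "finite A" and "finite S" and "\<And>e. e \<in> A \<Longrightarrow> card (ends e) = 2"
  shows "leibniz_det S (laplacian ends A x) =
    (\<Sum>T | T \<subseteq> A \<and> card T = card S \<and> grounded ends S T. \<Prod>e\<in>T. x e)"
  using assms
proof (induction "card A" arbitrary: A S rule: less_induct)
  case less
  let ?F = "\<lambda>S A. {T. T \<subseteq> A \<and> card T = card S \<and> grounded ends S T}"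
  show ?case
  proof (cases "S = {}")
    case True
    have "?F {} A = {{}}"
      using less.prems(1) by (auto simp: grounded_def card_eq_0_iff intro: finite_subset)
    then show ?thesis using True by (simp add: leibniz_det_empty)
  next
    case ne: False
    show ?thesis
    proof (cases "\<exists>e\<in>A. \<exists>i\<in>S. \<exists>r. r \<notin> S \<and> ends e = {i, r}")
      case False
      have laplacian_column: "(\<Sum>i\<in>S. laplacian ends A x i j) = 0" if j: "j \<in> S" for j
      proof -
        let ?c = "\<lambda>i e. (if i = j then if i \<in> ends e then 1 else 0 else if ends e = {i, j} then - 1 else 0) :: 'r"
        have "(\<Sum>i\<in>S. ?c i e) = 0" if e: "e \<in> A" for e
        proof (cases "j \<in> ends e")
          case True
          moreover obtain a b where "ends e = {a, b}" "a \<noteq> b"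
            using less.prems(3)[OF e] by (auto simp: card_2_iff)
          ultimately obtain k where k: "ends e = {j, k}" "k \<noteq> j"
            by (cases "a = j") (auto simp: insert_commute)
          then have "k \<in> S" using False e j by blast
          have "(\<Sum>i\<in>S. ?c i e) = ?c j e + (\<Sum>i\<in>S - {j}. ?c i e)"
            using less.prems(2) j by (rule sum.remove)
          also have "(\<Sum>i\<in>S - {j}. ?c i e) = ?c k e + (\<Sum>i\<in>S - {j} - {k}. ?c i e)"
            using less.prems(2) \<open>k \<in> S\<close> k by (intro sum.remove) auto
          also have "(\<Sum>i\<in>S - {j} - {k}. ?c i e) = 0"
            using k by (intro sum.neutral) (auto simp: doubleton_eq_iff)
          finally show ?thesis using k by (simp add: insert_commute)
        next
          case False
          then show ?thesis by (intro sum.neutral) auto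
        qed
        then show ?thesis
          unfolding laplacian_def by (subst sum.swap) (simp add: sum_distrib_right[symmetric])
      qed
      have "?F S A = {}"
      proof -
        have False if "T \<subseteq> A" "grounded ends S T" for T
        proof -
          from that(2) ne obtain e a b where "e \<in> T" "a \<in> S" "b \<notin> S" "ends e = {a, b}"
            unfolding grounded_def by blast
          then show False using that(1) False by blast
        qed
        then show ?thesis by blast
      qed
      then show ?thesis
        using leibniz_det_zero_column_sums[of S "laplacian ends A x", OF less.prems(2) ne laplacian_column]
        by (simp only: sum.empty)
    next
      case True
      then obtain e i r where e: "e \<in> A" "i \<in> S" "r \<notin> S" "ends e = {i, r}" by blast
      let ?A = "A - {e}"
      have lap: "laplacian ends A x a b = laplacian ends ?A x a b + (if a = i \<and> b = i then x e else 0)"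
        if "a \<in> S" "b \<in> S" for a b
        unfolding laplacian_def
        using that e less.prems(1) by (subst sum.remove[of A e]) (auto simp: doubleton_eq_iff)
      have IH: "leibniz_det S' (laplacian ends ?A x) = (\<Sum>T\<in>?F S' ?A. \<Prod>e\<in>T. x e)"
        if "finite S'" for S'
      proof (rule less.hyps)
        show "card ?A < card A" using less.prems(1) e(1) by (rule card_Diff1_less)
      qed (use less.prems that in auto)
      have part: "?F S A = ?F S ?A \<union> insert e ` ?F (S - {i}) ?A"
      proof (intro set_eqI iffI)
        fix T assume T: "T \<in> ?F S A"
        show "T \<in> ?F S ?A \<union> insert e ` ?F (S - {i}) ?A"
        proof (cases "e \<in> T")
          case True
          then have "T - {e} \<in> ?F (S - {i}) ?A"
            using T grounded_contract[OF True, of ends i r S] e less.prems(1,2)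
            by (auto simp: card_Diff_singleton)
          then have "insert e (T - {e}) \<in> insert e ` ?F (S - {i}) ?A" by (rule imageI)
          then show ?thesis using True by (simp only: insert_Diff Un_iff simp_thms)
        qed (use T in auto)
      next
        fix T assume T: "T \<in> ?F S ?A \<union> insert e ` ?F (S - {i}) ?A"
        then show "T \<in> ?F S A"
        proof
          assume "T \<in> insert e ` ?F (S - {i}) ?A"
          then obtain T' where T': "T = insert e T'" "T' \<subseteq> ?A" "card T' = card (S - {i})" "grounded ends (S - {i}) T'"
            by auto
          then have "T - {e} = T'" "finite T'" "e \<notin> T'" using less.prems(1) by (auto intro: finite_subset)
          moreover have "card S > 0" using e less.prems(2) by (auto simp: card_gt_0_iff)
          ultimately show ?thesis
            using T' grounded_contract[of e T ends i r S] e less.prems(2) by auto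
        qed auto
      qed
      have "leibniz_det S (laplacian ends A x) =
          leibniz_det S (\<lambda>a b. laplacian ends ?A x a b + (if a = i \<and> b = i then x e else 0))"
        using lap by (rule leibniz_det_cong)
      also have "\<dots> = leibniz_det S (laplacian ends ?A x) + x e * leibniz_det (S - {i}) (laplacian ends ?A x)"
        using less.prems(2) e(2) by (rule leibniz_det_add_diagonal)
      also have "\<dots> = (\<Sum>T\<in>?F S ?A. \<Prod>e\<in>T. x e) + (\<Sum>T\<in>?F (S - {i}) ?A. x e * (\<Prod>e\<in>T. x e))"
        using less.prems(2) by (simp add: IH sum_distrib_left)
      also have "(\<Sum>T\<in>?F (S - {i}) ?A. x e * (\<Prod>e\<in>T. x e)) = (\<Sum>T\<in>insert e ` ?F (S - {i}) ?A. \<Prod>e\<in>T. x e)"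
      proof (subst sum.reindex)
        show "inj_on (insert e) (?F (S - {i}) ?A)"
          by (rule inj_onI) (auto dest!: insert_ident[THEN iffD1, rotated 2])
        show "(\<Sum>T\<in>?F (S - {i}) ?A. x e * (\<Prod>e\<in>T. x e)) = sum ((\<lambda>T. \<Prod>e\<in>T. x e) \<circ> insert e) (?F (S - {i}) ?A)"
        proof (rule sum.cong)
          fix T assume "T \<in> ?F (S - {i}) ?A"
          then have "finite T" "e \<notin> T" using less.prems(1) by (auto intro: finite_subset)
          then show "x e * (\<Prod>e\<in>T. x e) = ((\<lambda>T. \<Prod>e\<in>T. x e) \<circ> insert e) T" by simp
        qed simp
      qed
      also have "(\<Sum>T\<in>?F S ?A. \<Prod>e\<in>T. x e) + (\<Sum>T\<in>insert e ` ?F (S - {i}) ?A. \<Prod>e\<in>T. x e) =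
          (\<Sum>T\<in>?F S A. \<Prod>e\<in>T. x e)"
        unfolding part
      proof (rule sum.union_disjoint[symmetric])
        show "finite (?F S ?A)" "finite (insert e ` ?F (S - {i}) ?A)"
          using less.prems(1) by auto
      qed auto
      finally show ?thesis .
    qed
  qed
qed

section \<open>Spanning trees and the graph polynomial\<close>

lemma rtrancl_leaves:
  assumes "(u, v) \<in> R\<^sup>*" and "u \<in> U" and "v \<notin> U"
  shows "\<exists>a b. (a, b) \<in> R \<and> a \<in> U \<and> b \<notin> U"
  using assms
proof (induction rule: rtrancl_induct)
  case (step y z)
  then show ?case by (cases "y \<in> U") auto
qed simp

lemma connected_by_iff_grounded:
  assumes simple: "simple_graph Vs ends" and v: "v \<in> Vs"
  shows "connected_by Vs ends T \<longleftrightarrow> grounded ends (Vs - {v}) T"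
proof
  assume c: "connected_by Vs ends T"
  show "grounded ends (Vs - {v}) T"
    unfolding grounded_def
  proof (intro allI impI)
    fix U assume U: "U \<subseteq> Vs - {v}" "U \<noteq> {}"
    then obtain u where u: "u \<in> U" "u \<in> Vs" by auto
    then have "(u, v) \<in> {(x, y). \<exists>e\<in>T. ends e = {x, y}}\<^sup>*"
      using c v by (auto simp: connected_by_def)
    from rtrancl_leaves[OF this u(1)] U
    show "\<exists>e\<in>T. \<exists>a\<in>U. \<exists>b. b \<notin> U \<and> ends e = {a, b}" by blast
  qed
next
  assume g: "grounded ends (Vs - {v}) T"
  let ?R = "{(x, y). \<exists>e\<in>T. ends e = {x, y}}"
  have "sym ?R" by (auto intro!: symI simp: insert_commute)
  then have "sym (?R\<^sup>*)" by (rule sym_rtrancl)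
  then have sym: "(y, x) \<in> ?R\<^sup>*" if "(x, y) \<in> ?R\<^sup>*" for x y
    using that by (rule symD)
  have reach: "(u, v) \<in> ?R\<^sup>*" if u: "u \<in> Vs" for u
  proof (rule ccontr)
    assume n: "(u, v) \<notin> ?R\<^sup>*"
    define U where "U = {w\<in>Vs. (w, v) \<notin> ?R\<^sup>*}"
    have "U \<subseteq> Vs - {v}" "U \<noteq> {}" using u n by (auto simp: U_def)
    then obtain e a b where e: "e \<in> T" "a \<in> U" "b \<notin> U" "ends e = {a, b}"
      using g unfolding grounded_def by blast
    then have "b \<in> Vs" using simple by (auto simp: simple_graph_def)
    then have "(b, v) \<in> ?R\<^sup>*" using e by (auto simp: U_def)
    moreover have "(a, b) \<in> ?R" using e by auto
    ultimately have "(a, v) \<in> ?R\<^sup>*" by (rule converse_rtrancl_into_rtrancl[rotated])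
    then show False using e by (simp add: U_def)
  qed
  show "connected_by Vs ends T"
    unfolding connected_by_def
  proof (intro conjI ballI)
    show "Vs \<noteq> {}" using v by auto
    show "(u, w) \<in> ?R\<^sup>*" if "u \<in> Vs" "w \<in> Vs" for u w
      using reach[OF that(1)] sym[OF reach[OF that(2)]] by (rule rtrancl_trans)
  qed
qed

text \<open>
  An edge of a cycle can be bypassed along the rest of the cycle. Conversely, a simple path that
  bypasses an edge closes up with it to a cycle, which has at least three vertices because there
  are no parallel edges.
\<close>

lemma cycle_iff_redundant_edge:
  assumes simple: "simple_graph Vs ends" and con: "connected_by Vs ends T"
  shows "(\<exists>vs. is_cycle ends T vs) \<longleftrightarrow> (\<exists>e\<in>T. connected_by Vs ends (T - {e}))"
proof
  assume "\<exists>vs. is_cycle ends T vs"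
  then obtain vs where len: "length vs \<ge> 3" and dist: "distinct vs"
    and edges: "\<And>i. i < length vs \<Longrightarrow> \<exists>e\<in>T. ends e = {vs ! i, vs ! (Suc i mod length vs)}"
    by (auto simp: is_cycle_def)
  \<comment> \<open>Remove the closing edge, from the last vertex of the cycle to the first.\<close>
  define n where "n = length vs - 1"
  have n: "length vs = Suc n" "n \<ge> 2" using len by (auto simp: n_def)
  obtain e where e: "e \<in> T" "ends e = {vs ! n, vs ! 0}"
    using edges[of n] n by auto
  let ?R = "\<lambda>T. {(x, y). \<exists>e\<in>T. ends e = {x, y}}"
  have step: "(vs ! i, vs ! Suc i) \<in> ?R (T - {e})" if i: "i < n" for i
  proof -
    have "Suc i mod length vs = Suc i" using n i by simp
    then obtain f where f: "f \<in> T" "ends f = {vs ! i, vs ! Suc i}"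
      using edges[of i] n(1) i by (metis less_SucI)
    have "{vs ! i, vs ! Suc i} \<noteq> {vs ! n, vs ! 0}"
      using i n dist by (auto simp: doubleton_eq_iff nth_eq_iff_index_eq)
    then have "f \<noteq> e" using f e by auto
    then show ?thesis using f by auto
  qed
  have path: "i \<le> n \<Longrightarrow> (vs ! 0, vs ! i) \<in> (?R (T - {e}))\<^sup>*" for i
  proof (induction i)
    case (Suc i)
    then show ?case using step[of i] by (meson Suc_leD Suc_le_lessD rtrancl.rtrancl_into_rtrancl)
  qed simp
  have "sym (?R (T - {e}))" by (auto intro!: symI simp: insert_commute)
  then have both: "(vs ! 0, vs ! n) \<in> (?R (T - {e}))\<^sup>*" "(vs ! n, vs ! 0) \<in> (?R (T - {e}))\<^sup>*"
    using path[of n] sym_rtrancl by (auto dest: symD)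
  have "?R T \<subseteq> (?R (T - {e}))\<^sup>*"
  proof clarify
    fix x y f assume f: "f \<in> T" "ends f = {x, y}"
    show "(x, y) \<in> (?R (T - {e}))\<^sup>*"
    proof (cases "f = e")
      case True
      then have "{x, y} = {vs ! n, vs ! 0}" using f e by simp
      then show ?thesis using both by (auto simp: doubleton_eq_iff)
    next
      case False
      then have "(x, y) \<in> ?R (T - {e})" using f by auto
      then show ?thesis by (rule r_into_rtrancl)
    qed
  qed
  then have "(?R T)\<^sup>* \<subseteq> (?R (T - {e}))\<^sup>*"
    by (rule rtrancl_subset_rtrancl)
  then have "connected_by Vs ends (T - {e})"
    using con unfolding connected_by_def by (meson subsetD)
  then show "\<exists>e\<in>T. connected_by Vs ends (T - {e})" using e by blast
next
  assume "\<exists>e\<in>T. connected_by Vs ends (T - {e})"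
  then obtain e where e: "e \<in> T" and con': "connected_by Vs ends (T - {e})" by blast
  obtain a b where ab: "ends e = {a, b}" "a \<noteq> b"
    using simple unfolding simple_graph_def by (meson card_2_iff)
  let ?r = "\<lambda>x y. \<exists>f\<in>T - {e}. ends f = {x, y}"
  have "a \<in> Vs" "b \<in> Vs" using simple ab unfolding simple_graph_def by blast+
  then have "(a, b) \<in> {(x, y). ?r x y}\<^sup>*"
    using con' unfolding connected_by_def by blast
  then have "?r\<^sup>*\<^sup>* a b" by (simp add: rtranclp_rtrancl_eq)
  then obtain xs0 where "rtrancl_path ?r a xs0 b"
    unfolding rtranclp_eq_rtrancl_path by blast
  then obtain xs where xs: "rtrancl_path ?r a xs b" "distinct (a # xs)"
    by (rule rtrancl_path_distinct)
  have ne: "xs \<noteq> []" using xs(1) ab by (auto elim: rtrancl_path.cases)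
  then have last: "last xs = b" by (rule rtrancl_path_last[OF xs(1)])
  have step: "?r ((a # xs) ! i) (xs ! i)" if "i < length xs" for i
    using rtrancl_path_nth[OF xs(1) that] .
  have "length xs \<noteq> 1"
  proof
    assume l: "length xs = 1"
    then have "xs = [b]" using last by (cases xs) auto
    then obtain f where "f \<in> T - {e}" "ends f = {a, b}" using step[of 0] by auto
    moreover have "inj ends" using simple by (simp add: simple_graph_def)
    ultimately show False using ab by (metis DiffE injD singletonI)
  qed
  then have "length (a # xs) \<ge> 3" using ne by (cases xs) (auto simp: Suc_le_eq)
  moreover have "\<exists>f\<in>T. ends f = {(a # xs) ! i, (a # xs) ! (Suc i mod length (a # xs))}"
    if i: "i < length (a # xs)" for i
  proof (cases "i = length xs")
    case True
    then have "(a # xs) ! i = b" using last ne by (simp add: last_conv_nth)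
    then show ?thesis using True e ab by (intro bexI[of _ e]) (auto simp: insert_commute)
  next
    case False
    then have "i < length xs" using i by simp
    then show ?thesis using step[of i] by auto
  qed
  ultimately have "is_cycle ends T (a # xs)"
    using xs(2) unfolding is_cycle_def by blast
  then show "\<exists>vs. is_cycle ends T vs" by blast
qed

lemma spanning_trees_eq:
  fixes ends :: "'e::finite \<Rightarrow> 'v set"
  assumes simple: "simple_graph Vs ends" and v: "v \<in> Vs"
  shows "spanning_trees Vs ends = {T. card T = card (Vs - {v}) \<and> grounded ends (Vs - {v}) T}"
proof -
  have fin: "finite (Vs - {v})" using simple by (simp add: simple_graph_def)
  have "T \<in> spanning_trees Vs ends \<longleftrightarrow> card T = card (Vs - {v}) \<and> grounded ends (Vs - {v}) T" for T
  proof (cases "grounded ends (Vs - {v}) T")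
    case True
    then have "(\<exists>vs. is_cycle ends T vs) \<longleftrightarrow> (\<exists>e\<in>T. grounded ends (Vs - {v}) (T - {e}))"
      using cycle_iff_redundant_edge[OF simple, of T]
      unfolding connected_by_iff_grounded[OF simple v] by (simp only: simp_thms)
    then show ?thesis
      unfolding spanning_trees_def mem_Collect_eq connected_by_iff_grounded[OF simple v]
      using True grounded_card_iff_minimal[OF fin finite True] by (simp only: simp_thms ball_simps bex_simps)
  next
    case False
    then show ?thesis
      unfolding spanning_trees_def mem_Collect_eq connected_by_iff_grounded[OF simple v] by (simp only: simp_thms)
  qed
  then show ?thesis by (intro set_eqI) (simp only: mem_Collect_eq)
qed

text \<open>
  Different trees give different monomials, so that all coefficients are \<open>0\<close> or \<open>1\<close> in \<open>'k\<close>.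
\<close>

lemma eval_graph_polynomial:
  fixes ends :: "'e::finite \<Rightarrow> 'v set" and \<iota> :: "'k::field \<Rightarrow> 'r::comm_ring_1"
  assumes \<iota>: "ring_map \<iota>"
  shows "eval_poly \<iota> (graph_polynomial Vs ends) x = (\<Sum>T\<in>spanning_trees Vs ends. \<Prod>e\<in>T. x $ e)"
proof -
  define mon where "mon T = (\<Sum>e\<in>T. Poly_Mapping.single e (1::nat))" for T :: "'e set"
  have look: "Poly_Mapping.lookup (mon T) e = (if e \<in> T then 1 else 0)" for T e
    by (simp add: mon_def lookup_sum lookup_single when_def)
  have inj: "mon T = mon T' \<longleftrightarrow> T = T'" for T T'
  proof
    assume "mon T = mon T'"
    then have "(if e \<in> T then 1 else 0 :: nat) = (if e \<in> T' then 1 else 0)" for e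
      using look by metis
    then show "T = T'" by (metis one_neq_zero subsetI subset_antisym)
  qed simp
  have prod_coord: "(\<Prod>e\<in>T. coord e) = Poly_Mapping.single (mon T) (1::'k)" for T
    using finite[of T]
  proof induction
    case empty
    then show ?case by (simp add: mon_def)
  next
    case (insert e T)
    then show ?case by (simp add: mon_def coord_def mult_single)
  qed
  let ?p = "graph_polynomial Vs ends :: ('e \<Rightarrow>\<^sub>0 nat) \<Rightarrow>\<^sub>0 'k" and ?S = "spanning_trees Vs ends"
  have lookp: "Poly_Mapping.lookup ?p m = (if m \<in> mon ` ?S then 1 else 0)" for m
  proof -
    have "Poly_Mapping.lookup ?p m = (\<Sum>T\<in>?S. if mon T = m then 1 else 0)"
      by (simp add: graph_polynomial_def prod_coord lookup_sum lookup_single when_def)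
    also have "\<dots> = (if m \<in> mon ` ?S then 1 else 0)"
    proof (cases "m \<in> mon ` ?S")
      case True
      then obtain T0 where "T0 \<in> ?S" "m = mon T0" by auto
      then show ?thesis by (simp add: inj)
    next
      case False
      then have "(\<Sum>T\<in>?S. if mon T = m then 1 else (0::'k)) = 0" by (intro sum.neutral) auto
      then show ?thesis using False by simp
    qed
    finally show ?thesis .
  qed
  have keys: "Poly_Mapping.keys ?p = mon ` ?S"
    by (auto simp: in_keys_iff lookp split: if_splits)
  have one: "\<iota> 1 = 1" using \<iota> by (simp add: ring_map_def)
  have "eval_poly \<iota> ?p x = (\<Sum>m\<in>mon ` ?S. \<Prod>e\<in>UNIV. x $ e ^ Poly_Mapping.lookup m e)"
    unfolding eval_poly_def keys by (intro sum.cong) (auto simp: lookp one)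
  also have "\<dots> = (\<Sum>T\<in>?S. \<Prod>e\<in>UNIV. x $ e ^ Poly_Mapping.lookup (mon T) e)"
    by (subst sum.reindex) (auto simp: inj inj_on_def)
  also have "\<dots> = (\<Sum>T\<in>?S. \<Prod>e\<in>T. x $ e)"
  proof (rule sum.cong)
    fix T
    have "(\<Prod>e\<in>UNIV. x $ e ^ Poly_Mapping.lookup (mon T) e) = (\<Prod>e\<in>UNIV. if e \<in> T then x $ e else 1)"
      by (intro prod.cong) (auto simp: look)
    also have "\<dots> = (\<Prod>e\<in>T. x $ e)"
      by (subst prod.inter_restrict[symmetric]) auto
    finally show "(\<Prod>e\<in>UNIV. x $ e ^ Poly_Mapping.lookup (mon T) e) = (\<Prod>e\<in>T. x $ e)" .
  qed simp
  finally show ?thesis .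
qed

lemma eval_graph_polynomial_eq_det:
  fixes ends :: "'e::finite \<Rightarrow> 'v set" and \<iota> :: "'k::field \<Rightarrow> 'r::comm_ring_1"
  assumes "ring_map \<iota>" and simple: "simple_graph Vs ends" and v: "v \<in> Vs"
  shows "eval_poly \<iota> (graph_polynomial Vs ends) x =
    leibniz_det (Vs - {v}) (laplacian ends UNIV (($) x))"
proof -
  have "finite (Vs - {v})" "\<And>e. card (ends e) = 2"
    using simple by (auto simp: simple_graph_def)
  then show ?thesis
    unfolding eval_graph_polynomial[OF assms(1)] spanning_trees_eq[OF simple v]
    by (simp only: matrix_tree[OF finite] subset_UNIV simp_thms)
qed

section \<open>Projections onto the weight spaces\<close>

lemma module_dual_scale: "module (dual_scale :: 'k::field \<Rightarrow> ('k ^ 'e::finite \<Rightarrow> 'k) \<Rightarrow> _)"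
  by standard (auto simp: dual_scale_def fun_eq_iff algebra_simps)

lemma dual_space_expand:
  assumes "f \<in> dual_space"
  shows "f x = (\<Sum>d\<in>UNIV. f (axis d 1) * x $ d)"
proof -
  interpret f: Vector_Spaces.linear "(*s)" "(*)" f
    using assms by (simp add: dual_space_def)
  have "f x = f (\<Sum>d\<in>UNIV. x $ d *s axis d 1)"
    by (simp add: basis_expansion)
  also have "\<dots> = (\<Sum>d\<in>UNIV. f (x $ d *s axis d 1))"
    by (rule f.sum)
  also have "\<dots> = (\<Sum>d\<in>UNIV. f (axis d 1) * x $ d)"
    by (simp add: f.scale mult.commute)
  finally show ?thesis .
qed

lemma to_dual_add: "to_dual (v + w) = to_dual v + to_dual w"
  by (simp add: to_dual_def fun_eq_iff sum.distrib algebra_simps)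

lemma to_dual_scale: "to_dual (c *s v) = dual_scale c (to_dual v)"
  by (simp add: to_dual_def dual_scale_def fun_eq_iff sum_distrib_left algebra_simps)

lemma to_dual_zero: "to_dual 0 = 0"
  by (simp add: to_dual_def fun_eq_iff)

lemma to_dual_axis: "to_dual w (axis e 1) = w $ e"
proof -
  have "to_dual w (axis e 1) = (\<Sum>d\<in>UNIV. if d = e then w $ d else 0)"
    unfolding to_dual_def by (intro sum.cong) (auto simp: axis_def)
  then show ?thesis by simp
qed

lemma to_dual_eq_0_iff: "to_dual w = 0 \<longleftrightarrow> w = 0"
proof
  assume "to_dual w = 0"
  then show "w = 0" using to_dual_axis[of w] by (simp add: vec_eq_iff)
qed (simp add: to_dual_zero)

lemma subspace_to_dual_image:
  assumes "vec.subspace H"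
  shows "module.subspace dual_scale (to_dual ` H)"
  unfolding module.subspace_def[OF module_dual_scale]
proof (intro conjI ballI allI)
  show "0 \<in> to_dual ` H" using vec.subspace_0[OF assms] to_dual_zero by (metis imageI)
  show "x + y \<in> to_dual ` H" if "x \<in> to_dual ` H" "y \<in> to_dual ` H" for x y
    using that vec.subspace_add[OF assms] by (auto simp: to_dual_add[symmetric])
  show "dual_scale c x \<in> to_dual ` H" if "x \<in> to_dual ` H" for c x
    using that vec.subspace_scale[OF assms] by (auto simp: to_dual_scale[symmetric])
qed

text \<open>
  A complete system of three orthogonal idempotent matrices. Grading by explicit matrices is
  convenient because these can be transported to any algebra entry by entry.
\<close>

definition weight_projections :: "(nat \<Rightarrow> 'k::field ^ 'e::finite ^ 'e) \<Rightarrow> bool" where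
  "weight_projections P \<longleftrightarrow>
     (\<Sum>i<3. P i) = mat 1 \<and> (\<forall>i<3. \<forall>j<3. P i ** P j = (if i = j then P i else 0))"

definition weight_space :: "(nat \<Rightarrow> 'k::field ^ 'e::finite ^ 'e) \<Rightarrow> nat \<Rightarrow> ('k ^ 'e) set" where
  "weight_space P i = {x. P i *v x = x}"

lemma matrix_vector_mult_sum_left:
  "(\<Sum>i\<in>I. P i) *v (x :: 'r::comm_ring_1 ^ 'n::finite) = (\<Sum>i\<in>I. P i *v x)"
  by (induction I rule: infinite_finite_induct) (auto simp: matrix_vector_mult_add_rdistrib)

text \<open>
  A decomposition of the dual space has three projections, and their transposes are the
  projections of the dual decomposition. Entry \<open>(e, d)\<close> of the matrix \<open>P i\<close> is therefore the value at the
  basis vector \<open>d\<close> of the component in \<open>U i\<close> of the coordinate function \<open>e\<close>.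
\<close>

lemma dual_decomposition_projections:
  fixes U :: "nat \<Rightarrow> ('k::field ^ 'e::finite \<Rightarrow> 'k) set"
  assumes sub: "\<And>i. i < 3 \<Longrightarrow> module.subspace dual_scale (U i)"
    and in_dual: "\<And>i. i < 3 \<Longrightarrow> U i \<subseteq> dual_space"
    and gen: "\<And>f. f \<in> dual_space \<Longrightarrow> \<exists>u. (\<forall>i<3. u i \<in> U i) \<and> (\<Sum>i<3. u i) = f"
    and indep: "\<And>u i. \<forall>i<3. u i \<in> U i \<Longrightarrow> (\<Sum>i<3. u i) = 0 \<Longrightarrow> i < 3 \<Longrightarrow> u i = 0"
  obtains P where "weight_projections P"
    and "\<And>i. i < 3 \<Longrightarrow> weight_space P i = {v. \<forall>j<3. j \<noteq> i \<longrightarrow> (\<forall>f\<in>U j. f v = 0)}"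
proof -
  have "(\<lambda>v. v $ e) \<in> dual_space" for e :: 'e
    unfolding dual_space_def mem_Collect_eq by unfold_locales auto
  from gen[OF this] obtain u where u: "\<And>e i. i < 3 \<Longrightarrow> u e i \<in> U i"
    and usum: "\<And>e. (\<Sum>i<3. u e i) = (\<lambda>v. v $ e)"
    by metis
  \<comment> \<open>\<open>u e i\<close> is the component in \<open>U i\<close> of the coordinate function \<open>e\<close>.\<close>
  define P where "P i = (\<chi> e d. u e i (axis d 1))" for i
  have Pv: "(P i *v x) $ e = u e i x" if "i < 3" for i x e
    using dual_space_expand[OF subsetD[OF in_dual[OF that] u[OF that]], of e x]
    by (simp add: P_def matrix_vector_mult_def)
  have sum_apply: "(\<Sum>i\<in>I. g i) x = (\<Sum>i\<in>I. g i x)" for I :: "'z set" and g :: "'z \<Rightarrow> 'k ^ 'e \<Rightarrow> 'k" and x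
    by (induction I rule: infinite_finite_induct) auto
  have Psum: "(\<Sum>i<3. P i *v x) = x" for x
  proof -
    have "(\<Sum>i<3. P i *v x) $ e = x $ e" for e
      using sum_apply[of "u e" "{..<3}" x] usum[of e] by (simp add: Pv)
    then show ?thesis by (simp add: vec_eq_iff)
  qed
  have dual_P: "f (P i *v x) = (if i = j then f x else 0)" if f: "f \<in> U j" and ij: "i < 3" "j < 3" for f i j x
  proof -
    \<comment> \<open>\<open>h i\<close> is \<open>f\<close> composed with \<open>P i\<close>; it lies in \<open>U i\<close>, and the \<open>h i\<close> add up to \<open>f\<close>.\<close>
    define h where "h i = (\<Sum>e\<in>UNIV. dual_scale (f (axis e 1)) (u e i))" for i
    have fd: "f \<in> dual_space" using f in_dual ij by auto
    have h: "h i y = f (P i *v y)" if "i < 3" for i y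
      using that by (simp add: h_def sum_apply dual_scale_def dual_space_expand[OF fd, of "P i *v y"] Pv)
    have hU: "h i \<in> U i" if "i < 3" for i
      unfolding h_def
      by (intro module.subspace_sum[OF module_dual_scale sub] module.subspace_scale[OF module_dual_scale sub] u that)
    have "(\<Sum>i<3. h i) = f"
    proof
      fix y
      have "(\<Sum>i<3. h i) y = (\<Sum>i<3. \<Sum>e\<in>UNIV. f (axis e 1) * u e i y)"
        by (simp add: sum_apply h_def dual_scale_def)
      also have "\<dots> = (\<Sum>e\<in>UNIV. f (axis e 1) * (\<Sum>i<3. u e i) y)"
        by (subst sum.swap) (simp add: sum_apply sum_distrib_left)
      also have "\<dots> = f y"
        by (simp add: usum dual_space_expand[OF fd, of y])
      finally show "(\<Sum>i<3. h i) y = f y" .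
    qed
    then have "(\<Sum>i<3. h i - (if i = j then f else 0)) = 0"
      using ij by (simp add: sum_subtractf)
    moreover have "\<forall>i<3. h i - (if i = j then f else 0) \<in> U i"
      using hU f module.subspace_diff[OF module_dual_scale sub] module.subspace_0[OF module_dual_scale sub] by auto
    ultimately have "h i - (if i = j then f else 0) = 0"
      using indep[of "\<lambda>i. h i - (if i = j then f else 0)" i] ij by blast
    then show ?thesis using h[OF ij(1), of x] by (auto split: if_splits)
  qed
  let ?V = "\<lambda>i. {v. \<forall>j<3. j \<noteq> i \<longrightarrow> (\<forall>f\<in>U j. f v = 0)}"
  have P_zero: "P j *v v = 0" if "v \<in> ?V i" "j < 3" "j \<noteq> i" for i j v
    using that u by (auto simp: vec_eq_iff Pv)
  have P_id: "P i *v v = v" if "v \<in> ?V i" "i < 3" for i v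
  proof -
    have "(\<Sum>j<3. P j *v v) = (\<Sum>j<3. if j = i then P i *v v else 0)"
      using P_zero[OF that(1)] by (intro sum.cong) auto
    then show ?thesis using Psum[of v] that by simp
  qed
  have P_in: "P i *v x \<in> ?V i" if "i < 3" for i x
    using that by (auto simp: dual_P)
  have V: "weight_space P i = ?V i" if "i < 3" for i
  proof (intro set_eqI iffI)
    fix x assume "x \<in> weight_space P i"
    then have "P i *v x = x" by (simp add: weight_space_def)
    with P_in[OF that, of x] show "x \<in> ?V i" by (simp only:)
  next
    fix x assume "x \<in> ?V i"
    then have "P i *v x = x" by (rule P_id[OF _ that])
    then show "x \<in> weight_space P i" by (simp add: weight_space_def)
  qed
  have PP: "P i *v (P j *v x) = (if i = j then P i *v x else 0)" if "i < 3" "j < 3" for i j x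
  proof (cases "i = j")
    case True
    then show ?thesis using P_id[OF P_in[OF that(2), of x] that(2)] by simp
  next
    case False
    then show ?thesis using P_zero[OF P_in[OF that(2), of x] that(1)] by simp
  qed
  have "P i ** P j = (if i = j then P i else 0)" if "i < 3" "j < 3" for i j
    by (simp add: matrix_eq matrix_vector_mul_assoc[symmetric] PP[OF that])
  moreover have "(\<Sum>i<3. P i) = mat 1"
    by (simp add: matrix_eq matrix_vector_mult_sum_left Psum)
  ultimately have "weight_projections P"
    unfolding weight_projections_def by blast
  then show thesis using V that by blast
qed

section \<open>Hadamard products of incidence vectors\<close>

lemma hadamard_span_sum:
  assumes W: "\<And>w. w \<in> W \<Longrightarrow> \<exists>a\<in>A. \<exists>b\<in>B. w = a + b" and x: "x \<in> hadamard_span W W"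
  shows "\<exists>a\<in>hadamard_span A A. \<exists>b\<in>hadamard_span A B. \<exists>c\<in>hadamard_span B B. x = a + b + c"
proof -
  let ?T = "{x + y | x y. x \<in> {x + y | x y. x \<in> hadamard_span A A \<and> y \<in> hadamard_span A B} \<and> y \<in> hadamard_span B B}"
  have base: "hadamard a b \<in> hadamard_span X Y" if "a \<in> X" "b \<in> Y" for a b and X Y :: "('k::field ^ 'e::finite) set"
    unfolding hadamard_span_def using that by (intro vec.span_base) auto
  have "hadamard_span W W \<subseteq> ?T"
    unfolding hadamard_span_def[of W W]
  proof (rule vec.span_minimal)
    show "vec.subspace ?T"
      unfolding hadamard_span_def by (intro vec.subspace_sums vec.subspace_span)
    show "{hadamard a b |a b. a \<in> W \<and> b \<in> W} \<subseteq> ?T"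
    proof clarify
      fix w w' assume "w \<in> W" "w' \<in> W"
      then obtain a b a' b' where ab: "a \<in> A" "b \<in> B" "w = a + b" "a' \<in> A" "b' \<in> B" "w' = a' + b'"
        using W by meson
      have "hadamard w w' = (hadamard a a' + (hadamard a b' + hadamard a' b)) + hadamard b b'"
        using ab by (simp add: hadamard_def vec_eq_iff algebra_simps)
      moreover have "hadamard a b' + hadamard a' b \<in> hadamard_span A B"
        using base[OF ab(1,5)] base[OF ab(4,2)] unfolding hadamard_span_def by (rule vec.span_add)
      ultimately show "\<exists>x y. hadamard w w' = x + y \<and> x \<in> {x + y | x y. x \<in> hadamard_span A A \<and> y \<in> hadamard_span A B} \<and> y \<in> hadamard_span B B"
        using base[OF ab(1,4)] base[OF ab(2,5)] by blast
    qed
  qed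
  then show ?thesis using x by blast
qed

lemma incidence_component:
  assumes "orientation ends src tgt"
  shows "incidence src tgt v $ e = (if v \<in> ends e then if src e = v then - 1 else 1 else 0)"
  using assms by (auto simp: orientation_def incidence_def)

lemma incidence_span_vanishes:
  assumes or: "orientation ends src tgt" and w: "w \<in> vec.span (incidence src tgt ` N)"
    and e: "ends e \<inter> N = {}"
  shows "(w :: 'k::field ^ 'e::finite) $ e = 0"
proof -
  have "vec.span (incidence src tgt ` N) \<subseteq> {w :: 'k ^ 'e. w $ e = 0}"
  proof (rule vec.span_minimal)
    show "incidence src tgt ` N \<subseteq> {w :: 'k ^ 'e. w $ e = 0}"
      using e by (auto simp: incidence_component[OF or])
    show "vec.subspace {w :: 'k ^ 'e. w $ e = 0}"
      unfolding vec.subspace_def by auto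
  qed
  then show ?thesis using w by auto
qed

text \<open>
  The entries of a combination of incidence vectors of \<open>N\<close> at two edges from \<open>u\<close> to the outside of \<open>N\<close> are
  both the coefficient of \<open>u\<close>, up to the signs of the orientation. In Hadamard products of two such
  vectors these signs cancel.
\<close>

lemma incidence_span_boundary:
  assumes or: "orientation ends src tgt" and w: "w \<in> vec.span (incidence src tgt ` N)"
    and e: "ends e = {u, x}" "x \<notin> N" and e': "ends e' = {u, y}" "y \<notin> N"
  shows "(if src e = u then - 1 else 1) * (w :: 'k::field ^ 'e::finite) $ e =
    (if src e' = u then - 1 else 1) * w $ e'"
proof -
  let ?T = "{w :: 'k ^ 'e. (if src e = u then - 1 else 1) * w $ e = (if src e' = u then - 1 else 1) * w $ e'}"
  have "vec.span (incidence src tgt ` N) \<subseteq> ?T"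
  proof (rule vec.span_minimal)
    show "incidence src tgt ` N \<subseteq> ?T"
      using e e' by (auto simp: incidence_component[OF or])
    show "vec.subspace ?T"
      unfolding vec.subspace_def by (auto simp: algebra_simps)
  qed
  then show ?thesis using w by auto
qed

lemma hadamard_incidence_span_vanishes:
  assumes or: "orientation ends src tgt"
    and z: "z \<in> hadamard_span (vec.span (incidence src tgt ` A)) (vec.span (incidence src tgt ` B))"
    and e: "ends e \<inter> A = {} \<or> ends e \<inter> B = {}"
  shows "(z :: 'k::field ^ 'e::finite) $ e = 0"
proof -
  have "hadamard_span (vec.span (incidence src tgt ` A)) (vec.span (incidence src tgt ` B)) \<subseteq>
      {z :: 'k ^ 'e. z $ e = 0}"
    unfolding hadamard_span_def
  proof (rule vec.span_minimal)
    show "{hadamard a b |a b. a \<in> vec.span (incidence src tgt ` A) \<and> b \<in> vec.span (incidence src tgt ` B)}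
        \<subseteq> {z :: 'k ^ 'e. z $ e = 0}"
      using incidence_span_vanishes[OF or] e by (fastforce simp: hadamard_def)
    show "vec.subspace {z :: 'k ^ 'e. z $ e = 0}"
      unfolding vec.subspace_def by auto
  qed
  then show ?thesis using z by auto
qed

lemma hadamard_incidence_span_boundary:
  assumes or: "orientation ends src tgt"
    and z: "z \<in> hadamard_span (vec.span (incidence src tgt ` N)) (vec.span (incidence src tgt ` N))"
    and e: "ends e = {u, x}" "x \<notin> N" and e': "ends e' = {u, y}" "y \<notin> N"
  shows "(z :: 'k::field ^ 'e::finite) $ e = z $ e'"
proof -
  have "hadamard_span (vec.span (incidence src tgt ` N)) (vec.span (incidence src tgt ` N)) \<subseteq>
      {z :: 'k ^ 'e. z $ e = z $ e'}"
    unfolding hadamard_span_def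
  proof (rule vec.span_minimal)
    show "{hadamard a b |a b. a \<in> vec.span (incidence src tgt ` N) \<and> b \<in> vec.span (incidence src tgt ` N)}
        \<subseteq> {z :: 'k ^ 'e. z $ e = z $ e'}"
    proof clarify
      fix a b :: "'k ^ 'e"
      assume ab: "a \<in> vec.span (incidence src tgt ` N)" "b \<in> vec.span (incidence src tgt ` N)"
      show "hadamard a b $ e = hadamard a b $ e'"
        using arg_cong2[where f="(*)", OF incidence_span_boundary[OF or ab(1) e e']
          incidence_span_boundary[OF or ab(2) e e']]
        by (simp add: hadamard_def split: if_splits)
    qed
    show "vec.subspace {z :: 'k ^ 'e. z $ e = z $ e'}"
      unfolding vec.subspace_def by auto
  qed
  then show ?thesis using z by auto
qed

text \<open>
  An edge from \<open>u\<close> in \<open>A\<close> to \<open>B\<close> is accompanied by an edge from \<open>u\<close> to \<open>v\<^sub>0\<close>, where \<open>z\<close> has the same entry.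
  This is where the fat nexus makes the sum of the spaces of Hadamard products direct.
\<close>

lemma hadamard_square_eq_0:
  assumes or: "orientation ends src tgt" and card: "\<And>e. card (ends e) = 2"
    and z: "z \<in> hadamard_span (vec.span (incidence src tgt ` A)) (vec.span (incidence src tgt ` A))"
    and zero: "\<And>e. ends e \<inter> B = {} \<Longrightarrow> (z :: 'k::field ^ 'e::finite) $ e = 0"
    and disj: "A \<inter> B = {}" "v\<^sub>0 \<notin> A" "v\<^sub>0 \<notin> B"
    and nexus: "\<And>e u w. u \<in> A \<Longrightarrow> w \<in> B \<Longrightarrow> ends e = {u, w} \<Longrightarrow> \<exists>e'. ends e' = {u, v\<^sub>0}"
  shows "z = 0"
proof -
  have "z $ e = 0" for e
  proof (cases "ends e \<inter> A = {} \<or> ends e \<inter> B = {}")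
    case True
    then show ?thesis using zero hadamard_incidence_span_vanishes[OF or z] by blast
  next
    case False
    then obtain u w where uw: "u \<in> A" "w \<in> B" "u \<in> ends e" "w \<in> ends e" by blast
    moreover have "u \<noteq> w" using uw disj by auto
    moreover obtain p q where "ends e = {p, q}" using card[of e] by (auto simp: card_2_iff)
    ultimately have e: "ends e = {u, w}" by auto
    then obtain e' where e': "ends e' = {u, v\<^sub>0}" using nexus uw by blast
    have "z $ e = z $ e'"
      using hadamard_incidence_span_boundary[OF or z e _ e'] uw disj by blast
    moreover have "ends e' \<inter> B = {}" using e' uw disj by auto
    ultimately show ?thesis using zero by simp
  qed
  then show ?thesis by (simp add: vec_eq_iff)
qed

lemma nexus_edge:
  assumes fat: "fat_nexus_partition Vs ends v\<^sub>0 N\<^sub>1 N\<^sub>2" and "u \<in> N\<^sub>1 \<union> N\<^sub>2"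
    and "ends e \<inter> N\<^sub>1 \<noteq> {}" "ends e \<inter> N\<^sub>2 \<noteq> {}" "u \<in> ends e"
  shows "\<exists>e'. ends e' = {u, v\<^sub>0}"
proof -
  have "ends e \<subseteq> nbhd Vs ends v\<^sub>0" using assms unfolding fat_nexus_partition_def by blast
  moreover have "u \<noteq> v\<^sub>0" using assms unfolding fat_nexus_partition_def by blast
  ultimately show ?thesis using assms(5) unfolding nbhd_def by blast
qed

text \<open>
  At edges that do not meet \<open>N\<^sub>2\<close> the vectors \<open>b\<close> and \<open>c\<close> vanish, hence so does \<open>a\<close>; this already
  determines \<open>a\<close>. The situation is symmetric for \<open>c\<close>.
\<close>

lemma hadamard_spans_independent:
  fixes a b c :: "'k::field ^ 'e::finite"
  assumes fat: "fat_nexus_partition Vs ends v\<^sub>0 N\<^sub>1 N\<^sub>2"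
    and or: "orientation ends src tgt" and card: "\<And>e. card (ends e) = 2"
    and a: "a \<in> hadamard_span (vec.span (incidence src tgt ` N\<^sub>1)) (vec.span (incidence src tgt ` N\<^sub>1))"
    and b: "b \<in> hadamard_span (vec.span (incidence src tgt ` N\<^sub>1)) (vec.span (incidence src tgt ` N\<^sub>2))"
    and c: "c \<in> hadamard_span (vec.span (incidence src tgt ` N\<^sub>2)) (vec.span (incidence src tgt ` N\<^sub>2))"
    and sum: "a + b + c = 0"
  shows "a = 0" "b = 0" "c = 0"
proof -
  have disj: "N\<^sub>1 \<inter> N\<^sub>2 = {}" "v\<^sub>0 \<notin> N\<^sub>1" "v\<^sub>0 \<notin> N\<^sub>2"
    using fat by (auto simp: fat_nexus_partition_def)
  have comp: "a $ e + b $ e + c $ e = 0" for e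
    using sum by (metis vector_add_component zero_index)
  show "a = 0"
  proof (rule hadamard_square_eq_0[OF or card a _ disj])
    show "a $ e = 0" if "ends e \<inter> N\<^sub>2 = {}" for e
      using comp[of e] hadamard_incidence_span_vanishes[OF or b, of e] hadamard_incidence_span_vanishes[OF or c, of e] that by simp
    show "\<exists>e'. ends e' = {u, v\<^sub>0}" if "u \<in> N\<^sub>1" "w \<in> N\<^sub>2" "ends e = {u, w}" for e u w
      using nexus_edge[OF fat, of u e] that by auto
  qed
  show "c = 0"
  proof (rule hadamard_square_eq_0[OF or card c])
    show "c $ e = 0" if "ends e \<inter> N\<^sub>1 = {}" for e
      using comp[of e] hadamard_incidence_span_vanishes[OF or b, of e] hadamard_incidence_span_vanishes[OF or a, of e] that by simp
    show "\<exists>e'. ends e' = {u, v\<^sub>0}" if "u \<in> N\<^sub>2" "w \<in> N\<^sub>1" "ends e = {u, w}" for e u w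
      using nexus_edge[OF fat, of u e] that by auto
  qed (use disj in auto)
  show "b = 0" using sum \<open>a = 0\<close> \<open>c = 0\<close> by simp
qed

text \<open>
  The incidence vectors of all vertices add up to zero, so that the one of \<open>v\<^sub>0\<close> is redundant.
\<close>

lemma incidence_span_split:
  fixes w :: "'k::field ^ 'e::finite"
  assumes simple: "simple_graph Vs ends" and fat: "fat_nexus_partition Vs ends v\<^sub>0 N\<^sub>1 N\<^sub>2"
    and or: "orientation ends src tgt" and w: "w \<in> vec.span (incidence src tgt ` Vs)"
  shows "\<exists>a\<in>vec.span (incidence src tgt ` N\<^sub>1). \<exists>b\<in>vec.span (incidence src tgt ` N\<^sub>2). w = a + b"
proof -
  let ?i = "incidence src tgt :: _ \<Rightarrow> 'k ^ 'e"
  let ?N = "N\<^sub>1 \<union> N\<^sub>2"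
  have fin: "finite Vs" and Vs: "Vs = insert v\<^sub>0 ?N" and v0: "v\<^sub>0 \<notin> ?N"
    using simple fat by (auto simp: simple_graph_def fat_nexus_partition_def)
  have "(\<Sum>v\<in>Vs. ?i v) = 0"
  proof -
    have "(\<Sum>v\<in>Vs. ?i v $ e) = 0" for e
    proof -
      have st: "ends e = {src e, tgt e}" using or by (simp add: orientation_def)
      have ne: "src e \<noteq> tgt e" and sub: "src e \<in> Vs" "tgt e \<in> Vs"
        using simple st by (auto simp: simple_graph_def dest!: spec[of _ e])
      have "(\<Sum>v\<in>Vs. ?i v $ e) = (\<Sum>v\<in>Vs. (if v = src e then - 1 else 0) + (if v = tgt e then 1 else 0))"
        using ne by (intro sum.cong) (auto simp: incidence_def)
      then show ?thesis using fin sub by (simp add: sum.distrib)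
    qed
    then show ?thesis by (simp add: vec_eq_iff)
  qed
  then have "?i v\<^sub>0 = - (\<Sum>v\<in>?N. ?i v)"
    using fin v0 Vs by (simp add: eq_neg_iff_add_eq_0)
  moreover have "(\<Sum>v\<in>?N. ?i v) \<in> vec.span (?i ` ?N)"
    by (intro vec.span_sum vec.span_base) auto
  ultimately have "?i v\<^sub>0 \<in> vec.span (?i ` ?N)"
    by (simp add: vec.span_neg)
  then have "?i ` Vs \<subseteq> vec.span (?i ` ?N)"
    using Vs vec.span_base[of _ "?i ` ?N"] by auto
  then have "vec.span (?i ` Vs) \<subseteq> vec.span (?i ` ?N)"
    by (rule vec.span_minimal) (rule vec.subspace_span)
  then have "w \<in> vec.span (?i ` N\<^sub>1 \<union> ?i ` N\<^sub>2)"
    using w by (auto simp: image_Un)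
  then show ?thesis unfolding vec.span_Un by clarify (rule bexI, rule bexI, rule refl)
qed


lemma sum_lessThan_3: "(\<Sum>i<3. f i) = f 0 + f 1 + f (2::nat)"
  by (simp add: eval_nat_numeral add.assoc)

lemma less_3_cases: "(i::nat) < 3 \<Longrightarrow> (i = 0 \<Longrightarrow> Q) \<Longrightarrow> (i = 1 \<Longrightarrow> Q) \<Longrightarrow> (i = 2 \<Longrightarrow> Q) \<Longrightarrow> Q"
  by linarith

lemma hadamard_span_mono:
  "A \<subseteq> A' \<Longrightarrow> B \<subseteq> B' \<Longrightarrow> hadamard_span A B \<subseteq> hadamard_span A' B'"
  unfolding hadamard_span_def by (rule vec.span_mono) blast

text \<open>
  Weights of the rows and columns of the Laplacian; the entry at \<open>(i, j)\<close> is then homogeneous of weight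
  \<open>nexus_weight N i + nexus_weight N j\<close>.
\<close>

definition nexus_weight :: "'v set \<Rightarrow> 'v \<Rightarrow> nat" where
  "nexus_weight N v = (if v \<in> N then 0 else 1)"

lemma laplacian_eq_to_dual:
  assumes or: "orientation ends src tgt" and card: "\<And>e. card (ends e) = 2"
  shows "laplacian ends UNIV (($) x) i j =
    to_dual (hadamard (incidence src tgt i) (incidence src tgt j)) (x :: 'k::field ^ 'e::finite)"
proof -
  have "(if i = j then if i \<in> ends e then 1 else 0 else if ends e = {i, j} then - 1 else 0) =
      (incidence src tgt i $ e * incidence src tgt j $ e :: 'k)" for e
  proof -
    have st: "ends e = {src e, tgt e}" using or by (simp add: orientation_def)
    then have "src e \<noteq> tgt e" using card[of e] by auto
    then show ?thesis using st by (auto simp: incidence_def doubleton_eq_iff)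
  qed
  then show ?thesis by (simp add: laplacian_def to_dual_def hadamard_def)
qed

text \<open>
  The Hadamard product of the incidence vectors of \<open>i\<close> and \<open>j\<close> lies in the summand whose index is the sum
  of the two weights, and the weight spaces of other indices annihilate this summand.
\<close>

lemma nexus_weight_projections:
  fixes V\<^sub>1 V\<^sub>2 V\<^sub>3 :: "('k::field ^ 'e::finite) set"
  assumes simple: "simple_graph Vs ends" and fat: "fat_nexus_partition Vs ends v\<^sub>0 N\<^sub>1 N\<^sub>2"
    and or: "orientation ends src tgt"
    and dec: "nexus_decomposition src tgt Vs N\<^sub>1 N\<^sub>2 V\<^sub>1 V\<^sub>2 V\<^sub>3"
  obtains P where "weight_projections P"
    and "V\<^sub>1 = weight_space P 0" "V\<^sub>2 = weight_space P 1" "V\<^sub>3 = weight_space P 2"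
    and "\<And>k x i j. k < 3 \<Longrightarrow> x \<in> weight_space P k \<Longrightarrow> i \<in> N\<^sub>1 \<union> N\<^sub>2 \<Longrightarrow> j \<in> N\<^sub>1 \<union> N\<^sub>2 \<Longrightarrow>
      nexus_weight N\<^sub>1 i + nexus_weight N\<^sub>1 j \<noteq> k \<Longrightarrow> laplacian ends UNIV (($) x) i j = 0"
proof -
  have card: "card (ends e) = 2" for e using simple by (simp add: simple_graph_def)
  let ?i = "incidence src tgt :: _ \<Rightarrow> 'k ^ 'e"
  define W where "W = vec.span (?i ` Vs)"
  define W1 where "W1 = vec.span (?i ` N\<^sub>1)"
  define W2 where "W2 = vec.span (?i ` N\<^sub>2)"
  define H where "H i = (if i = 0 then hadamard_span W1 W1 else if i = 1 then hadamard_span W1 W2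
    else hadamard_span W2 W2)" for i :: nat
  have H: "H 0 = hadamard_span W1 W1" "H 1 = hadamard_span W1 W2" "H 2 = hadamard_span W2 W2"
    by (auto simp: H_def)
  have subH: "vec.subspace (H i)" for i
    by (simp add: H_def hadamard_span_def vec.subspace_span)
  have "N\<^sub>1 \<subseteq> Vs" "N\<^sub>2 \<subseteq> Vs"
    using fat by (auto simp: fat_nexus_partition_def)
  then have "W1 \<subseteq> W" "W2 \<subseteq> W"
    unfolding W_def W1_def W2_def by (simp_all only: vec.span_mono image_mono)
  then have HW: "H i \<subseteq> hadamard_span W W" for i
    by (simp add: H_def hadamard_span_mono)
  have split: "\<exists>h. (\<forall>i<3. h i \<in> H i) \<and> z = h 0 + h 1 + h 2" if "z \<in> hadamard_span W W" for z
  proof -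
    have "\<exists>a\<in>hadamard_span W1 W1. \<exists>b\<in>hadamard_span W1 W2. \<exists>c\<in>hadamard_span W2 W2. z = a + b + c"
      using incidence_span_split[OF simple fat or] that
      unfolding W_def W1_def W2_def by (intro hadamard_span_sum) auto
    then obtain a b c where "a \<in> H 0" "b \<in> H 1" "c \<in> H 2" "z = a + b + c"
      unfolding H by blast
    then show ?thesis
      by (intro exI[of _ "\<lambda>i. if i = 0 then a else if i = 1 then b else c"]) (auto elim!: less_3_cases)
  qed
  have indepH: "h i = 0" if "\<forall>i<3. h i \<in> H i" "h 0 + h 1 + h 2 = 0" "i < 3" for h i
  proof -
    have "h 0 \<in> H 0" "h 1 \<in> H 1" "h 2 \<in> H 2" using that by auto
    from hadamard_spans_independent[OF fat or card this[unfolded H W1_def W2_def] that(2)]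
    show ?thesis using that(3) by (auto elim!: less_3_cases)
  qed
  have "\<exists>C U1 U2 U3. direct_complement dual_scale dual_space (to_dual ` hadamard_span W W) C \<and>
      (U1 = to_dual ` H 0 + C \<and> U2 = to_dual ` H 1 \<and> U3 = to_dual ` H 2 \<or>
       U1 = to_dual ` H 0 \<and> U2 = to_dual ` H 1 + C \<and> U3 = to_dual ` H 2 \<or>
       U1 = to_dual ` H 0 \<and> U2 = to_dual ` H 1 \<and> U3 = to_dual ` H 2 + C) \<and>
      V\<^sub>1 = annihilator (U2 + U3) \<and> V\<^sub>2 = annihilator (U1 + U3) \<and> V\<^sub>3 = annihilator (U1 + U2)"
    using dec unfolding nexus_decomposition_def Let_def H unfolding W_def W1_def W2_def .
  then obtain C U1 U2 U3 where
    C: "direct_complement dual_scale dual_space (to_dual ` hadamard_span W W) C" and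
    U: "U1 = to_dual ` H 0 + C \<and> U2 = to_dual ` H 1 \<and> U3 = to_dual ` H 2 \<or>
        U1 = to_dual ` H 0 \<and> U2 = to_dual ` H 1 + C \<and> U3 = to_dual ` H 2 \<or>
        U1 = to_dual ` H 0 \<and> U2 = to_dual ` H 1 \<and> U3 = to_dual ` H 2 + C" and
    V: "V\<^sub>1 = annihilator (U2 + U3)" "V\<^sub>2 = annihilator (U1 + U3)" "V\<^sub>3 = annihilator (U1 + U2)"
  proof (elim exE conjE)
    fix C U1 U2 U3
    assume "direct_complement dual_scale dual_space (to_dual ` hadamard_span W W) C"
      and "U1 = to_dual ` H 0 + C \<and> U2 = to_dual ` H 1 \<and> U3 = to_dual ` H 2 \<or>
        U1 = to_dual ` H 0 \<and> U2 = to_dual ` H 1 + C \<and> U3 = to_dual ` H 2 \<or>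
        U1 = to_dual ` H 0 \<and> U2 = to_dual ` H 1 \<and> U3 = to_dual ` H 2 + C"
      and "V\<^sub>1 = annihilator (U2 + U3)" "V\<^sub>2 = annihilator (U1 + U3)" "V\<^sub>3 = annihilator (U1 + U2)"
    then show thesis by (rule that)
  qed
  have subC: "module.subspace dual_scale C" and QC: "to_dual ` hadamard_span W W + C = dual_space"
    and disj: "to_dual ` hadamard_span W W \<inter> C = {0}"
    using C unfolding direct_complement_def by - (elim conjE, assumption)+
  have C0: "0 \<in> C" using module.subspace_0[OF module_dual_scale subC] .
  \<comment> \<open>\<open>m\<close> is the index of the summand that is enlarged by the complement \<open>C\<close>.\<close>
  define D where "D m i = (if i = m then C else {0})" for m i :: nat
  \<comment> \<open>The given subspaces \<open>U1\<close>, \<open>U2\<close>, \<open>U3\<close>, uniformly in the index and in the three alternatives.\<close>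
  define U where "U m i = to_dual ` H i + D m i" for m i
  have plus_0: "X + {0} = X" for X :: "('k ^ 'e \<Rightarrow> 'k) set"
    by (auto simp: set_plus_def)
  have "\<exists>m<3. U1 = U m 0 \<and> U2 = U m 1 \<and> U3 = U m 2"
    using U
  proof (elim disjE conjE)
    assume "U1 = to_dual ` H 0 + C" "U2 = to_dual ` H 1" "U3 = to_dual ` H 2"
    then have "U1 = U 0 0 \<and> U2 = U 0 1 \<and> U3 = U 0 2"
      by (simp add: U_def D_def plus_0)
    then show ?thesis by (intro exI[of _ 0] conjI) simp_all
  next
    assume "U1 = to_dual ` H 0" "U2 = to_dual ` H 1 + C" "U3 = to_dual ` H 2"
    then have "U1 = U 1 0 \<and> U2 = U 1 1 \<and> U3 = U 1 2"
      by (simp add: U_def D_def plus_0)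
    then show ?thesis by (intro exI[of _ 1] conjI) simp_all
  next
    assume "U1 = to_dual ` H 0" "U2 = to_dual ` H 1" "U3 = to_dual ` H 2 + C"
    then have "U1 = U 2 0 \<and> U2 = U 2 1 \<and> U3 = U 2 2"
      by (simp add: U_def D_def plus_0)
    then show ?thesis by (intro exI[of _ 2] conjI) simp_all
  qed
  then obtain m where m: "m < 3" and Um: "U1 = U m 0" "U2 = U m 1" "U3 = U m 2" by blast
  have subD: "module.subspace dual_scale (D m i)" for i
    using subC by (simp add: D_def module.subspace_single_0[OF module_dual_scale])
  have subU: "module.subspace dual_scale (U m i)" for i
  proof -
    have "U m i = {x + y | x y. x \<in> to_dual ` H i \<and> y \<in> D m i}"
      by (auto simp: U_def set_plus_def)
    then show ?thesis
      using vector_space.subspace_sums[OF module_dual_scale[unfolded module_iff_vector_space] subspace_to_dual_image[OF subH[of i]] subD[of i]] by simp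
  qed
  have zero: "0 \<in> U m i" for i using module.subspace_0[OF module_dual_scale subU] .
  have DC: "D m i \<subseteq> C" for i using C0 by (auto simp: D_def)
  have in_dual: "U m i \<subseteq> dual_space" for i
    unfolding U_def QC[symmetric] using HW[of i] DC[of i] by (intro set_plus_mono2) auto
  have gen: "\<exists>u. (\<forall>i<3. u i \<in> U m i) \<and> (\<Sum>i<3. u i) = f" if "f \<in> dual_space" for f
  proof -
    obtain z c where z: "z \<in> hadamard_span W W" and c: "c \<in> C" and f: "f = to_dual z + c"
      using \<open>f \<in> dual_space\<close> unfolding QC[symmetric] by (auto elim!: set_plus_elim)
    obtain h where h: "\<forall>i<3. h i \<in> H i" "z = h 0 + h 1 + h 2" using split[OF z] by blast
    define u where "u i = to_dual (h i) + (if i = m then c else 0)" for i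
    have "\<forall>i<3. u i \<in> U m i"
      unfolding u_def U_def using h(1) c by (intro allI impI set_plus_intro) (auto simp: D_def)
    moreover have "(\<Sum>i<3. u i) = f"
    proof -
      have "(\<Sum>i<3. u i) = (\<Sum>i<3. to_dual (h i)) + (\<Sum>i<3. if i = m then c else 0)"
        unfolding u_def by (rule sum.distrib)
      then show ?thesis using m by (simp add: f h(2) to_dual_add sum_lessThan_3)
    qed
    ultimately show ?thesis by blast
  qed
  have indep: "u i = 0" if u: "\<forall>i<3. u i \<in> U m i" and su: "(\<Sum>i<3. u i) = 0" and "i < 3" for u i
  proof -
    have "\<forall>i. \<exists>h c. i < 3 \<longrightarrow> h \<in> H i \<and> c \<in> D m i \<and> u i = to_dual h + c"
      using u unfolding U_def by (blast elim: set_plus_elim)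
    then obtain h c where hc: "\<And>i. i < 3 \<Longrightarrow> h i \<in> H i" "\<And>i. i < 3 \<Longrightarrow> c i \<in> D m i"
      "\<And>i. i < 3 \<Longrightarrow> u i = to_dual (h i) + c i"
      by metis
    have c0: "c i = 0" if "i < 3" "i \<noteq> m" for i
      using hc(2)[OF that(1)] that(2) by (simp add: D_def)
    have "(\<Sum>i<3. c i) = (\<Sum>i<3. if i = m then c m else 0)"
      using c0 by (intro sum.cong) auto
    then have csum: "(\<Sum>i<3. c i) = c m" using m by simp
    have q: "to_dual (h 0 + h 1 + h 2) + c m = 0"
    proof -
      have "0 = (\<Sum>i<3. to_dual (h i) + c i)"
        using su hc(3) by simp
      also have "\<dots> = (\<Sum>i<3. to_dual (h i)) + (\<Sum>i<3. c i)"
        by (rule sum.distrib)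
      also have "\<dots> = to_dual (h 0 + h 1 + h 2) + c m"
        unfolding csum by (simp add: sum_lessThan_3 to_dual_add)
      finally show ?thesis by simp
    qed
    have "h i \<in> hadamard_span W W" if "i < 3" for i
      using hc(1)[OF that] HW[of i] by (rule subsetD[rotated])
    then have "h 0 + h 1 + h 2 \<in> hadamard_span W W"
      unfolding hadamard_span_def by (intro vec.span_add) simp_all
    then have "- (h 0 + h 1 + h 2) \<in> hadamard_span W W"
      unfolding hadamard_span_def by (rule vec.span_neg)
    moreover have cm: "to_dual (- (h 0 + h 1 + h 2)) = c m"
    proof -
      have "to_dual (- (h 0 + h 1 + h 2)) + to_dual (h 0 + h 1 + h 2) = 0"
        unfolding to_dual_add[symmetric] by (simp add: to_dual_zero)
      then have "to_dual (- (h 0 + h 1 + h 2)) = - to_dual (h 0 + h 1 + h 2)"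
        by (simp only: eq_neg_iff_add_eq_0)
      also have "\<dots> = c m"
        using q by (simp only: minus_unique)
      finally show ?thesis .
    qed
    ultimately have "c m \<in> to_dual ` hadamard_span W W"
      using imageI[of "- (h 0 + h 1 + h 2)" "hadamard_span W W" to_dual] by simp
    moreover have "c m \<in> C" using hc(2)[OF m] by (simp add: D_def)
    ultimately have "c m \<in> {0}" unfolding disj[symmetric] by (rule IntI)
    then have cm: "c m = 0" by simp
    then have "h 0 + h 1 + h 2 = 0" using q by (simp add: to_dual_eq_0_iff)
    then have "h i = 0" using indepH[of h i] hc(1) \<open>i < 3\<close> by blast
    moreover have "c i = 0" using c0[of i] cm \<open>i < 3\<close> by (cases "i = m") auto
    ultimately show ?thesis using hc(3)[OF \<open>i < 3\<close>] by (simp add: to_dual_zero)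
  qed
  obtain P where P: "weight_projections P"
    and PV: "\<And>i. i < 3 \<Longrightarrow> weight_space P i = {v. \<forall>j<3. j \<noteq> i \<longrightarrow> (\<forall>f\<in>U m j. f v = 0)}"
  proof (rule dual_decomposition_projections[of "U m"])
    show "module.subspace dual_scale (U m i)" for i by (rule subU)
    show "U m i \<subseteq> dual_space" for i by (rule in_dual)
    show "\<exists>u. (\<forall>i<3. u i \<in> U m i) \<and> (\<Sum>i<3. u i) = f" if "f \<in> dual_space" for f
      using that by (rule gen)
    show "u i = 0" if "\<forall>i<3. u i \<in> U m i" "(\<Sum>i<3. u i) = 0" "i < 3" for u i
      using that by (rule indep)
  qed (rule that)
  have ann: "annihilator (U m i + U m j) = {v. (\<forall>f\<in>U m i. f v = 0) \<and> (\<forall>f\<in>U m j. f v = 0)}" for i j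
  proof -
    have "f \<in> U m i + U m j" if "f \<in> U m i" for f
      using set_plus_intro[OF that zero[of j]] by simp
    moreover have "f \<in> U m i + U m j" if "f \<in> U m j" for f
      using set_plus_intro[OF zero[of i] that] by simp
    moreover have "f v = 0" if "f \<in> U m i + U m j" "\<forall>f\<in>U m i. f v = 0" "\<forall>f\<in>U m j. f v = 0" for f v
      using that by (auto elim!: set_plus_elim)
    ultimately show ?thesis
      unfolding annihilator_def by (intro Collect_cong) blast
  qed
  have all3: "(\<forall>j<3. Q j) \<longleftrightarrow> Q 0 \<and> Q 1 \<and> Q 2" for Q :: "nat \<Rightarrow> bool"
    by (simp add: eval_nat_numeral All_less_Suc conj_ac)
  have "V\<^sub>1 = weight_space P 0" "V\<^sub>2 = weight_space P 1" "V\<^sub>3 = weight_space P 2"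
    unfolding V Um ann by (simp_all add: PV all3)
  moreover have "laplacian ends UNIV (($) x) i j = 0"
    if k: "k < 3" and x: "x \<in> weight_space P k" and i: "i \<in> N\<^sub>1 \<union> N\<^sub>2" and j: "j \<in> N\<^sub>1 \<union> N\<^sub>2"
      and d: "nexus_weight N\<^sub>1 i + nexus_weight N\<^sub>1 j \<noteq> k" for k x i j
  proof -
    let ?d = "nexus_weight N\<^sub>1 i + nexus_weight N\<^sub>1 j"
    have in_W1: "?i v \<in> W1" if "v \<in> N\<^sub>1" for v using that by (simp add: W1_def vec.span_base)
    have in_W2: "?i v \<in> W2" if "v \<in> N\<^sub>2" for v using that by (simp add: W2_def vec.span_base)
    have gen: "hadamard a b \<in> hadamard_span X Y" "hadamard a b \<in> hadamard_span Y X" if "a \<in> X" "b \<in> Y"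
      for a b and X Y :: "('k ^ 'e) set"
    proof -
      show "hadamard a b \<in> hadamard_span X Y"
        unfolding hadamard_span_def using that by (intro vec.span_base) blast
      have "hadamard a b = hadamard b a" by (simp add: hadamard_def mult.commute)
      then show "hadamard a b \<in> hadamard_span Y X"
        unfolding hadamard_span_def using that by (intro vec.span_base) blast
    qed
    have "hadamard (?i i) (?i j) \<in> H ?d"
    proof (cases "i \<in> N\<^sub>1"; cases "j \<in> N\<^sub>1")
      assume "i \<in> N\<^sub>1" "j \<in> N\<^sub>1"
      then show ?thesis using gen(1)[OF in_W1 in_W1] by (simp add: nexus_weight_def H)
    next
      assume "i \<in> N\<^sub>1" "j \<notin> N\<^sub>1"
      then show ?thesis using gen(1)[OF in_W1 in_W2] j by (simp add: nexus_weight_def H_def)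
    next
      assume "i \<notin> N\<^sub>1" "j \<in> N\<^sub>1"
      then show ?thesis using gen(2)[OF in_W2 in_W1] i by (simp add: nexus_weight_def H_def)
    next
      assume "i \<notin> N\<^sub>1" "j \<notin> N\<^sub>1"
      then show ?thesis using gen(1)[OF in_W2 in_W2] i j by (simp add: nexus_weight_def H_def)
    qed
    then have "to_dual (hadamard (?i i) (?i j)) + 0 \<in> U m ?d"
      unfolding U_def using C0 by (intro set_plus_intro) (auto simp: D_def)
    moreover have "?d < 3" by (simp add: nexus_weight_def)
    ultimately have "to_dual (hadamard (?i i) (?i j)) x = 0"
      using x PV[OF k] d by simp
    then show ?thesis by (simp add: laplacian_eq_to_dual[OF or card])
  qed
  ultimately show thesis using P that by blast
qed

section \<open>The torus action over an algebra\<close>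

interpretation cart: module "(*s) :: 'r::comm_ring_1 \<Rightarrow> 'r ^ 'n::finite \<Rightarrow> 'r ^ 'n"
  by unfold_locales (auto simp: vec_eq_iff algebra_simps)

lemma ring_map_simps:
  assumes "ring_map \<iota>"
  shows "\<iota> 0 = 0" "\<iota> 1 = 1" "\<iota> (x + y) = \<iota> x + \<iota> y" "\<iota> (x * y) = \<iota> x * \<iota> y" "\<iota> (- x) = - \<iota> x"
    "\<iota> (sum g I) = (\<Sum>i\<in>I. \<iota> (g i))" "\<iota> (x ^ n) = \<iota> x ^ n"
proof -
  have add: "\<iota> (x + y) = \<iota> x + \<iota> y" and mult: "\<iota> (x * y) = \<iota> x * \<iota> y" and one: "\<iota> 1 = 1" for x y
    using assms by (auto simp: ring_map_def)
  show zero: "\<iota> 0 = 0" using add[of 0 0] by simp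
  show "\<iota> (- x) = - \<iota> x" using add[of "- x" x] zero by (simp add: eq_neg_iff_add_eq_0)
  show "\<iota> (sum g I) = (\<Sum>i\<in>I. \<iota> (g i))"
    by (induction I rule: infinite_finite_induct) (auto simp: add zero)
  show "\<iota> (x ^ n) = \<iota> x ^ n"
    by (induction n) (auto simp: mult one)
qed (use assms in \<open>auto simp: ring_map_def\<close>)

definition map_vec :: "('r::comm_ring_1 \<Rightarrow> 's::comm_ring_1) \<Rightarrow> 'r ^ 'n::finite \<Rightarrow> 's ^ 'n" where
  "map_vec \<phi> v = (\<chi> i. \<phi> (v $ i))"

definition map_mat :: "('r::comm_ring_1 \<Rightarrow> 's::comm_ring_1) \<Rightarrow> 'r ^ 'n::finite ^ 'm::finite \<Rightarrow> 's ^ 'n ^ 'm" where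
  "map_mat \<phi> A = (\<chi> i j. \<phi> (A $ i $ j))"

lemma base_change_eq_span: "base_change \<phi> A = module.span (*s) (map_vec \<phi> ` A)"
  by (simp add: base_change_def map_vec_def[abs_def])

lemma map_mat_vec:
  "ring_map \<phi> \<Longrightarrow> map_mat \<phi> A *v map_vec \<phi> v = map_vec \<phi> (A *v v)"
  by (simp add: map_mat_def map_vec_def matrix_vector_mult_def vec_eq_iff ring_map_simps)

lemma map_mat_comp: "map_mat (\<phi> \<circ> \<iota>) A = map_mat \<phi> (map_mat \<iota> A)"
  by (simp add: map_mat_def)

lemma map_mat_mult: "ring_map \<phi> \<Longrightarrow> map_mat \<phi> (A ** B) = map_mat \<phi> A ** map_mat \<phi> B"
  by (simp add: map_mat_def matrix_matrix_mult_def vec_eq_iff ring_map_simps)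

lemma map_mat_sum: "ring_map \<phi> \<Longrightarrow> map_mat \<phi> (\<Sum>i\<in>I. A i) = (\<Sum>i\<in>I. map_mat \<phi> (A i))"
  by (simp add: map_mat_def vec_eq_iff ring_map_simps)

lemma map_mat_zero: "ring_map \<phi> \<Longrightarrow> map_mat \<phi> 0 = 0"
  by (simp add: map_mat_def vec_eq_iff ring_map_simps)

lemma map_mat_one: "ring_map \<phi> \<Longrightarrow> map_mat \<phi> (mat 1) = mat 1"
  by (simp add: map_mat_def mat_def vec_eq_iff ring_map_simps)

lemma map_vec_scale: "ring_map \<phi> \<Longrightarrow> map_vec \<phi> (c *s v) = \<phi> c *s map_vec \<phi> v"
  by (simp add: map_vec_def vec_eq_iff ring_map_simps)

lemma map_vec_sum: "ring_map \<phi> \<Longrightarrow> map_vec \<phi> (\<Sum>i\<in>I. v i) = (\<Sum>i\<in>I. map_vec \<phi> (v i))"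
  by (simp add: map_vec_def vec_eq_iff ring_map_simps)

lemma matrix_vector_mult_scale: "A *v (c *s x) = c *s (A *v (x :: 'r::comm_ring_1 ^ 'n::finite))"
  by (simp add: matrix_vector_mult_def vec_eq_iff sum_distrib_left algebra_simps)

lemma matrix_vector_mult_sum_right:
  "A *v (\<Sum>i\<in>I. (x i :: 'r::comm_ring_1 ^ 'n::finite)) = (\<Sum>i\<in>I. A *v x i)"
  by (induction I rule: infinite_finite_induct) (auto simp: matrix_vector_right_distrib)

text \<open>
  The base change of the image of an idempotent matrix is the image of the same matrix over the
  algebra, which is generated by its columns.
\<close>

lemma base_change_weight_space:
  fixes P :: "nat \<Rightarrow> 'k::field ^ 'e::finite ^ 'e"
  assumes P: "weight_projections P" and k: "k < 3" and \<iota>: "ring_map \<iota>"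
  shows "base_change \<iota> (weight_space P k) = {x. map_mat \<iota> (P k) *v x = x}"
proof
  have "cart.subspace {x. map_mat \<iota> (P k) *v x = x}"
    unfolding cart.subspace_def by (auto simp: matrix_vector_right_distrib matrix_vector_mult_scale)
  then show "base_change \<iota> (weight_space P k) \<subseteq> {x. map_mat \<iota> (P k) *v x = x}"
    unfolding base_change_eq_span
    by (intro cart.span_minimal) (auto simp: weight_space_def map_mat_vec[OF \<iota>])
  show "{x. map_mat \<iota> (P k) *v x = x} \<subseteq> base_change \<iota> (weight_space P k)"
  proof clarify
    fix x :: "_ ^ 'e" assume x: "map_mat \<iota> (P k) *v x = x"
    have "map_vec \<iota> (axis e 1) = axis e 1" for e :: 'e
      by (simp add: map_vec_def axis_def vec_eq_iff ring_map_simps[OF \<iota>])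
    then have "map_mat \<iota> (P k) *v axis e 1 = map_vec \<iota> (P k *v axis e 1)" for e :: 'e
      using map_mat_vec[OF \<iota>, of "P k" "axis e 1"] by simp
    moreover have "P k *v (P k *v axis e 1) = P k *v axis e 1" for e :: 'e
      using P k by (auto simp: weight_projections_def matrix_vector_mul_assoc)
    ultimately have mem: "map_mat \<iota> (P k) *v axis e 1 \<in> base_change \<iota> (weight_space P k)" for e :: 'e
      unfolding base_change_eq_span by (auto simp: weight_space_def intro!: cart.span_base)
    have "x = map_mat \<iota> (P k) *v (\<Sum>e\<in>UNIV. x $ e *s axis e 1)"
      by (simp add: basis_expansion x)
    also have "\<dots> = (\<Sum>e\<in>UNIV. x $ e *s (map_mat \<iota> (P k) *v axis e 1))"
      by (simp add: matrix_vector_mult_sum_right matrix_vector_mult_scale)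
    also have "\<dots> \<in> base_change \<iota> (weight_space P k)"
      using mem unfolding base_change_eq_span by (intro cart.span_sum cart.span_scale)
    finally show "x \<in> base_change \<iota> (weight_space P k)" .
  qed
qed

lemma weight_components:
  fixes P :: "nat \<Rightarrow> 'k::field ^ 'e::finite ^ 'e"
  assumes P: "weight_projections P" and \<iota>: "ring_map \<iota>"
  shows "(\<Sum>i<3. map_mat \<iota> (P i) *v x) = x"
    and "i < 3 \<Longrightarrow> j < 3 \<Longrightarrow>
      map_mat \<iota> (P i) *v (map_mat \<iota> (P j) *v x) = (if i = j then map_mat \<iota> (P j) *v x else 0)"
proof -
  have "(\<Sum>i<3. map_mat \<iota> (P i)) = mat 1"
    using P by (simp add: map_mat_sum[OF \<iota>, symmetric] map_mat_one[OF \<iota>] weight_projections_def)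
  then show "(\<Sum>i<3. map_mat \<iota> (P i) *v x) = x"
    by (simp add: matrix_vector_mult_sum_left[symmetric])
  show "map_mat \<iota> (P i) *v (map_mat \<iota> (P j) *v x) = (if i = j then map_mat \<iota> (P j) *v x else 0)"
    if "i < 3" "j < 3"
    using P that by (simp add: matrix_vector_mul_assoc map_mat_mult[OF \<iota>, symmetric] map_mat_zero[OF \<iota>]
      weight_projections_def)
qed

text \<open>
  The linear map of \<open>'r ^ 'e\<close> that induces \<open>gm_act\<close> on submodules.
\<close>

definition torus_map :: "('k::field \<Rightarrow> 'r::comm_ring_1) \<Rightarrow> (nat \<Rightarrow> 'k ^ 'e::finite ^ 'e) \<Rightarrow> 'r \<Rightarrow> 'r ^ 'e \<Rightarrow> 'r ^ 'e" where
  "torus_map \<iota> P t x = (\<Sum>i<3. t ^ i *s (map_mat \<iota> (P i) *v x))"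

lemma torus_map_add: "torus_map \<iota> P t (x + y) = torus_map \<iota> P t x + torus_map \<iota> P t y"
  by (simp add: torus_map_def matrix_vector_right_distrib cart.scale_right_distrib sum.distrib)

lemma torus_map_scale: "torus_map \<iota> P t (c *s x) = c *s torus_map \<iota> P t x"
  by (simp add: torus_map_def matrix_vector_mult_scale cart.scale_sum_right mult.commute)

lemma torus_map_component:
  assumes P: "weight_projections P" and \<iota>: "ring_map \<iota>" and "i < 3"
  shows "map_mat \<iota> (P i) *v torus_map \<iota> P t x = t ^ i *s (map_mat \<iota> (P i) *v x)"
proof -
  have "map_mat \<iota> (P i) *v torus_map \<iota> P t x =
      (\<Sum>j<3. t ^ j *s (map_mat \<iota> (P i) *v (map_mat \<iota> (P j) *v x)))"
    by (simp add: torus_map_def matrix_vector_mult_sum_right matrix_vector_mult_scale)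
  also have "\<dots> = (\<Sum>j<3. if j = i then t ^ i *s (map_mat \<iota> (P i) *v x) else 0)"
    using assms by (intro sum.cong) (auto simp: weight_components(2)[OF P \<iota>])
  finally show ?thesis using \<open>i < 3\<close> by simp
qed

lemma torus_map_mult:
  assumes "weight_projections P" and "ring_map \<iota>"
  shows "torus_map \<iota> P (s * t) x = torus_map \<iota> P s (torus_map \<iota> P t x)"
  unfolding torus_map_def[of \<iota> P s] torus_map_def[of \<iota> P "s * t"]
  by (intro sum.cong) (auto simp: torus_map_component[OF assms] power_mult_distrib)

lemma torus_map_one:
  assumes "weight_projections P" and "ring_map \<iota>"
  shows "torus_map \<iota> P 1 x = x"
  by (simp add: torus_map_def weight_components(1)[OF assms])

lemma gm_act_eq_image:
  assumes P: "weight_projections P" and \<iota>: "ring_map \<iota>"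
  shows "gm_act \<iota> (weight_space P 0) (weight_space P 1) (weight_space P 2) t L = torus_map \<iota> P t ` L"
proof (intro set_eqI iffI)
  let ?Q = "\<lambda>i. map_mat \<iota> (P i)"
  note bc = base_change_weight_space[OF P _ \<iota>]
  note comp = weight_components[OF P \<iota>]
  {
    fix y assume "y \<in> gm_act \<iota> (weight_space P 0) (weight_space P 1) (weight_space P 2) t L"
    then obtain v0 v1 v2 where y: "y = v0 + t *s v1 + t ^ 2 *s v2" and L: "v0 + v1 + v2 \<in> L"
      and v: "?Q 0 *v v0 = v0" "?Q 1 *v v1 = v1" "?Q 2 *v v2 = v2"
      unfolding gm_act_def using bc[of 0] bc[of 1] bc[of 2] by auto
    have "?Q 0 *v v1 = 0" "?Q 0 *v v2 = 0" "?Q 1 *v v0 = 0" "?Q 1 *v v2 = 0" "?Q 2 *v v0 = 0" "?Q 2 *v v1 = 0"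
      using comp(2)[of 0 1 v1] comp(2)[of 0 2 v2] comp(2)[of 1 0 v0] comp(2)[of 1 2 v2]
        comp(2)[of 2 0 v0] comp(2)[of 2 1 v1] by (simp_all add: v[simplified])
    then have "torus_map \<iota> P t (v0 + v1 + v2) = y"
      by (simp add: torus_map_def sum_lessThan_3 matrix_vector_right_distrib v[simplified] y)
    then show "y \<in> torus_map \<iota> P t ` L" using L by blast
  next
    fix y assume "y \<in> torus_map \<iota> P t ` L"
    then obtain x where x: "x \<in> L" "y = torus_map \<iota> P t x" by blast
    have "?Q i *v x \<in> base_change \<iota> (weight_space P i)" if "i < 3" for i
      using comp(2)[OF that that] by (simp add: bc[OF that])
    from this[of 0] this[of 1] this[of 2] have mem: "?Q 0 *v x \<in> base_change \<iota> (weight_space P 0)"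
      "?Q 1 *v x \<in> base_change \<iota> (weight_space P 1)" "?Q 2 *v x \<in> base_change \<iota> (weight_space P 2)"
      by simp_all
    have "?Q 0 *v x + ?Q 1 *v x + ?Q 2 *v x = x"
      using comp(1)[of x] unfolding sum_lessThan_3 .
    moreover have "y = ?Q 0 *v x + t *s (?Q 1 *v x) + t ^ 2 *s (?Q 2 *v x)"
      unfolding x(2) torus_map_def sum_lessThan_3 by simp
    ultimately show "y \<in> gm_act \<iota> (weight_space P 0) (weight_space P 1) (weight_space P 2) t L"
      unfolding gm_act_def using mem x(1) by (intro CollectI exI conjI) (assumption | simp)+
  }
qed

lemma torus_map_base_change:
  assumes \<iota>: "ring_map \<iota>" and \<phi>: "ring_map \<phi>"
  shows "map_vec \<phi> (torus_map \<iota> P t x) = torus_map (\<phi> \<circ> \<iota>) P (\<phi> t) (map_vec \<phi> x)"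
  by (simp add: torus_map_def map_mat_comp map_vec_sum[OF \<phi>] map_vec_scale[OF \<phi>]
      map_mat_vec[OF \<phi>, symmetric] ring_map_simps[OF \<phi>])

lemma base_change_torus_image:
  assumes \<iota>: "ring_map \<iota>" and \<phi>: "ring_map \<phi>"
  shows "base_change \<phi> (torus_map \<iota> P t ` L) = torus_map (\<phi> \<circ> \<iota>) P (\<phi> t) ` base_change \<phi> L"
proof -
  have "module_hom (*s) (*s) (torus_map (\<phi> \<circ> \<iota>) P (\<phi> t))"
    by unfold_locales (auto simp: torus_map_add torus_map_scale)
  from module_hom.span_image[OF this, of "map_vec \<phi> ` L"] show ?thesis
    unfolding base_change_eq_span image_image by (simp add: torus_map_base_change[OF \<iota> \<phi>])
qed

section \<open>Lines over a ring\<close>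

lemma proj_points_subspace:
  "L \<in> proj_points M \<Longrightarrow> cart.subspace L"
  by (auto simp: proj_points_def direct_complement_def)

lemma proj_points_subset:
  assumes "L \<in> proj_points M" shows "L \<subseteq> M"
proof
  fix x assume x: "x \<in> L"
  obtain N where N: "cart.subspace N" "L + N = M"
    using assms by (auto simp: proj_points_def direct_complement_def)
  have "x + 0 \<in> M"
    unfolding N(2)[symmetric] by (rule set_plus_intro[OF x cart.subspace_0[OF N(1)]])
  then show "x \<in> M" by simp
qed

lemma proj_points_image:
  fixes f g :: "'r::comm_ring_1 ^ 'e::finite \<Rightarrow> 'r ^ 'e"
  assumes add: "\<And>x y. f (x + y) = f x + f y" and scale: "\<And>c x. f (c *s x) = c *s f x"
    and gf: "\<And>x. g (f x) = x" and fg: "\<And>x. f (g x) = x" and L: "L \<in> proj_points UNIV"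
  shows "f ` L \<in> proj_points UNIV"
proof -
  have hom: "module_hom (*s) (*s) f" by unfold_locales (auto simp: add scale)
  have f0: "f 0 = 0" using module_hom.zero[OF hom] .
  have f_eq_0: "x = 0" if "f x = 0" for x using gf[of x] gf[of 0] that f0 by simp
  obtain N where N: "cart.subspace L" "cart.subspace N" "L + N = UNIV" "L \<inter> N = {0}"
    using L by (auto simp: proj_points_def direct_complement_def)
  have "f ` L + f ` N = UNIV"
  proof -
    have "y \<in> f ` L + f ` N" for y
    proof -
      have "g y \<in> L + N" using N(3) by simp
      then obtain a b where ab: "g y = a + b" "a \<in> L" "b \<in> N" by (rule set_plus_elim)
      have "y = f a + f b" using fg[of y] unfolding ab(1) add by (rule sym)
      then show ?thesis using set_plus_intro[OF imageI[OF ab(2), of f] imageI[OF ab(3), of f]] by simp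
    qed
    then show ?thesis by blast
  qed
  moreover have "f ` L \<inter> f ` N = {0}"
  proof -
    have "f a = 0" if "a \<in> L" "b \<in> N" "f a = f b" for a b
    proof -
      have "a = b" using arg_cong[OF that(3), of g] unfolding gf .
      then have "a \<in> L \<inter> N" using that by simp
      then show ?thesis using N(4) f0 by simp
    qed
    then have "f ` L \<inter> f ` N \<subseteq> {0}" by blast
    moreover have "0 \<in> f ` L" "0 \<in> f ` N"
      using imageI[OF cart.subspace_0[OF N(1)], of f] imageI[OF cart.subspace_0[OF N(2)], of f] f0 by simp_all
    ultimately show ?thesis by blast
  qed
  ultimately have "direct_complement (*s) UNIV (f ` L) (f ` N)"
    unfolding direct_complement_def
    using module_hom.subspace_image[OF hom N(1)] module_hom.subspace_image[OF hom N(2)] by simp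
  moreover have free: "free_rank_one_away s (f ` L)" if s: "free_rank_one_away s L" for s
  proof -
    obtain l where l: "l \<in> L" "\<And>x. x \<in> L \<Longrightarrow> \<exists>n r. s ^ n *s x = r *s l"
      "\<And>r. r *s l = 0 \<Longrightarrow> \<exists>n. s ^ n * r = 0"
      using s unfolding free_rank_one_away_def by blast
    have "\<exists>n r. s ^ n *s f x = r *s f l" if "x \<in> L" for x
      using l(2)[OF that] scale by metis
    moreover have "\<exists>n. s ^ n * r = 0" if "r *s f l = 0" for r
      using l(3)[of r] f_eq_0[of "r *s l"] that by (simp add: scale)
    ultimately show ?thesis
      unfolding free_rank_one_away_def using l(1) by blast
  qed
  moreover have "locally_free_rank_one (f ` L)"
  proof -
    have "locally_free_rank_one L" using L by (simp add: proj_points_def)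
    then show ?thesis unfolding locally_free_rank_one_def using free by meson
  qed
  ultimately show ?thesis unfolding proj_points_def by blast
qed

lemma power_sum_annihilates:
  fixes a b z :: "'r::comm_ring_1"
  assumes a: "a ^ m * z = 0" and b: "b ^ n * z = 0"
  shows "(a + b) ^ (m + n) * z = 0"
proof -
  have "of_nat ((m + n) choose k) * a ^ k * b ^ (m + n - k) * z = 0" if "k \<le> m + n" for k
  proof (cases "m \<le> k")
    case True
    then have "a ^ k * z = a ^ (k - m) * (a ^ m * z)" by (simp add: power_add[symmetric] mult.assoc[symmetric])
    then have "a ^ k * z = 0" using a by simp
    moreover have "of_nat ((m + n) choose k) * a ^ k * b ^ (m + n - k) * z =
        of_nat ((m + n) choose k) * b ^ (m + n - k) * (a ^ k * z)"
      by (simp add: ac_simps)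
    ultimately show ?thesis by simp
  next
    case False
    then have "b ^ (m + n - k) * z = b ^ (m - k) * (b ^ n * z)" by (simp add: power_add[symmetric] mult.assoc[symmetric])
    then have "b ^ (m + n - k) * z = 0" using b by simp
    then show ?thesis by (simp add: mult.assoc)
  qed
  then show ?thesis by (simp add: binomial_ring sum_distrib_right)
qed

text \<open>
  If elements \<open>s\<close> generate the unit ideal, then so do their powers: a high power of the combination that
  equals \<open>1\<close> annihilates \<open>z\<close>.
\<close>

lemma zero_if_locally_zero:
  fixes z :: "'r::comm_ring_1"
  assumes "finite F" and "(\<Sum>s\<in>F. c s * s) = 1" and "\<And>s. s \<in> F \<Longrightarrow> \<exists>n. s ^ n * z = 0"
  shows "z = 0"
proof -
  have "\<exists>n. (\<Sum>s\<in>F. c s * s) ^ n * z = 0"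
    using assms(1,3)
  proof (induction F)
    case empty
    then show ?case by (intro exI[of _ 1]) simp
  next
    case (insert s F)
    then obtain n where "(\<Sum>s\<in>F. c s * s) ^ n * z = 0" by auto
    moreover obtain m where "s ^ m * z = 0" using insert.prems by blast
    then have "(c s * s) ^ m * z = 0" by (simp add: power_mult_distrib mult.assoc)
    ultimately have "(c s * s + (\<Sum>s\<in>F. c s * s)) ^ (m + n) * z = 0"
      by (rule power_sum_annihilates[rotated])
    then show ?case using insert.hyps by (intro exI[of _ "m + n"]) simp
  qed
  then show ?thesis using assms(2) by simp
qed

lemma locally_free_rank_one_faithful:
  assumes L: "locally_free_rank_one L" and r: "\<And>x. x \<in> L \<Longrightarrow> r *s x = 0"
  shows "r = 0"
proof -
  obtain F c where F: "finite F" "(\<Sum>s\<in>F. c s * s) = 1" "\<And>s. s \<in> F \<Longrightarrow> free_rank_one_away s L"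
    using L unfolding locally_free_rank_one_def by blast
  have "\<exists>n. s ^ n * r = 0" if "s \<in> F" for s
    using F(3)[OF that] r unfolding free_rank_one_away_def by blast
  with F(1,2) show ?thesis by (rule zero_if_locally_zero)
qed

text \<open>
  Locally both vectors are multiples of one vector.
\<close>

lemma locally_free_rank_one_minors:
  assumes L: "locally_free_rank_one L" and x: "x \<in> L" and y: "y \<in> L"
  shows "x $ e * y $ f = x $ f * y $ e"
proof -
  obtain F c where F: "finite F" "(\<Sum>s\<in>F. c s * s) = 1" "\<And>s. s \<in> F \<Longrightarrow> free_rank_one_away s L"
    using L unfolding locally_free_rank_one_def by blast
  have "\<exists>n. s ^ n * (x $ e * y $ f - x $ f * y $ e) = 0" if s: "s \<in> F" for s
  proof -
    obtain l where l: "\<And>x. x \<in> L \<Longrightarrow> \<exists>n r. s ^ n *s x = r *s l"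
      using F(3)[OF s] unfolding free_rank_one_away_def by blast
    obtain n r where nr: "s ^ n *s x = r *s l" using l[OF x] by blast
    obtain m q where mq: "s ^ m *s y = q *s l" using l[OF y] by blast
    have sx: "s ^ n * x $ d = r * l $ d" and sy: "s ^ m * y $ d = q * l $ d" for d
      using arg_cong[OF nr, of "\<lambda>v. v $ d"] arg_cong[OF mq, of "\<lambda>v. v $ d"] by simp_all
    have "s ^ (n + m) * (x $ e * y $ f - x $ f * y $ e) =
        (s ^ n * x $ e) * (s ^ m * y $ f) - (s ^ n * x $ f) * (s ^ m * y $ e)"
      by (simp add: power_add algebra_simps)
    also have "\<dots> = 0" unfolding sx sy by (simp add: algebra_simps)
    finally show ?thesis by blast
  qed
  with F(1,2) have "x $ e * y $ f - x $ f * y $ e = 0" by (rule zero_if_locally_zero)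
  then show ?thesis by simp
qed

text \<open>
  The scalar is the trace of \<open>A\<close> after a projection onto \<open>L\<close>, so that no gluing of local scalars is needed:
  the vanishing of the \<open>2\<close> by \<open>2\<close> minors turns the trace formula into the action of \<open>A\<close>.
\<close>

lemma endomorphism_of_line_is_scalar:
  fixes A :: "'r::comm_ring_1 ^ 'e::finite ^ 'e"
  assumes L: "L \<in> proj_points UNIV" and A: "\<And>x. x \<in> L \<Longrightarrow> A *v x \<in> L"
  shows "\<exists>a. \<forall>x\<in>L. A *v x = a *s x"
proof -
  obtain N where N: "cart.subspace L" "cart.subspace N" "L + N = UNIV" "L \<inter> N = {0}"
    using L by (auto simp: proj_points_def direct_complement_def)
  \<comment> \<open>The images of the standard basis under the projection onto \<open>L\<close> along \<open>N\<close>.\<close>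
  have "\<exists>p. p \<in> L \<and> axis e 1 - p \<in> N" for e
  proof -
    have "axis e 1 \<in> L + N" using N(3) by simp
    then obtain a b where "axis e 1 = a + b" "a \<in> L" "b \<in> N" by (rule set_plus_elim)
    then show ?thesis by (intro exI[of _ a]) simp
  qed
  then obtain p where p: "\<And>e. p e \<in> L" "\<And>e. axis e 1 - p e \<in> N" by metis
  have expand: "x = (\<Sum>e\<in>UNIV. x $ e *s p e)" if x: "x \<in> L" for x
  proof -
    have "x - (\<Sum>e\<in>UNIV. x $ e *s p e) = (\<Sum>e\<in>UNIV. x $ e *s axis e 1) - (\<Sum>e\<in>UNIV. x $ e *s p e)"
      by (simp add: basis_expansion)
    also have "\<dots> = (\<Sum>e\<in>UNIV. x $ e *s (axis e 1 - p e))"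
      by (simp add: cart.scale_right_diff_distrib sum_subtractf)
    also have "\<dots> \<in> N"
      using p(2) by (intro cart.subspace_sum[OF N(2)] cart.subspace_scale[OF N(2)])
    finally have "x - (\<Sum>e\<in>UNIV. x $ e *s p e) \<in> N" .
    moreover have "x - (\<Sum>e\<in>UNIV. x $ e *s p e) \<in> L"
      using p(1) x by (intro cart.subspace_diff[OF N(1)] cart.subspace_sum[OF N(1)] cart.subspace_scale[OF N(1)])
    ultimately have "x - (\<Sum>e\<in>UNIV. x $ e *s p e) \<in> {0}" unfolding N(4)[symmetric] by (rule IntI[rotated])
    then show ?thesis by simp
  qed
  have lf: "locally_free_rank_one L" using L by (simp add: proj_points_def)
  define a where "a = (\<Sum>e\<in>UNIV. (A *v p e) $ e)"
  have "A *v x = a *s x" if x: "x \<in> L" for x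
  proof -
    have "(A *v x) $ f = a * x $ f" for f
    proof -
      have "A *v x = (\<Sum>e\<in>UNIV. x $ e *s (A *v p e))"
        by (subst expand[OF x]) (simp add: matrix_vector_mult_sum_right matrix_vector_mult_scale)
      then have "(A *v x) $ f = (\<Sum>e\<in>UNIV. x $ e * (A *v p e) $ f)" by simp
      also have "\<dots> = (\<Sum>e\<in>UNIV. (A *v p e) $ e * x $ f)"
        using locally_free_rank_one_minors[OF lf x A[OF p(1)]]
        by (intro sum.cong) (auto simp: mult.commute)
      finally show ?thesis by (simp add: a_def sum_distrib_right)
    qed
    then show ?thesis by (simp add: vec_eq_iff)
  qed
  then show ?thesis by blast
qed

section \<open>Fixed lines\<close>

lemma ring_map_comp: "ring_map f \<Longrightarrow> ring_map g \<Longrightarrow> ring_map (g \<circ> f)"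
  by (simp add: ring_map_def)

lemma ring_map_laurent_const: "ring_map laurent_const"
  by (simp add: ring_map_def laurent_const_def single_add mult_single)

lemma lookup_mult_laurent_const:
  "Poly_Mapping.lookup (p * laurent_const c) n = Poly_Mapping.lookup p n * c"
proof (induction p rule: update_induct)
  case const
  then show ?case by simp
next
  case (update f a b)
  have upd: "Poly_Mapping.update a b f = f + Poly_Mapping.single a b"
    using update(1) by (intro poly_mapping_eqI) (auto simp: lookup_update lookup_add lookup_single when_def in_keys_iff)
  show ?case
    unfolding upd
    using update(3) by (simp add: distrib_right lookup_add laurent_const_def mult_single lookup_single when_def)
qed

lemma laurent_var_power: "laurent_var ^ i = Poly_Mapping.single (int i) 1"
  by (induction i) (simp_all add: laurent_var_def mult_single)

text \<open>
  Multiplication by a constant acts on each coefficient separately, so that the coefficients of a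
  Laurent polynomial times an element of \<open>L\<close> are multiples of this element.
\<close>

lemma laurent_coefficient_in_line:
  assumes L: "cart.subspace L" and z: "z \<in> base_change laurent_const L"
  shows "(\<chi> e. Poly_Mapping.lookup (z $ e) n) \<in> L"
  using z unfolding base_change_eq_span
proof (induction rule: cart.span_induct_alt)
  case base
  then show ?case using cart.subspace_0[OF L] by (simp add: zero_vec_def)
next
  case (step c x y)
  then obtain v where v: "v \<in> L" "x = map_vec laurent_const v" by auto
  have "(\<chi> e. Poly_Mapping.lookup ((c *s x + y) $ e) n) =
      Poly_Mapping.lookup c n *s v + (\<chi> e. Poly_Mapping.lookup (y $ e) n)"
    by (simp add: vec_eq_iff v(2) map_vec_def lookup_add lookup_mult_laurent_const)
  then show ?case
    using step v(1) cart.subspace_add[OF L] cart.subspace_scale[OF L] by simp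
qed

text \<open>
  The coefficients of the image of \<open>x\<close> under the universal point of the torus are the
  components of \<open>x\<close>. Conversely, a line that contains the components of its elements is stable under
  all \<open>torus_map\<close>s, in particular under the inverse of the universal point.
\<close>

lemma torus_fixed_line_iff:
  fixes P :: "nat \<Rightarrow> 'k::field ^ 'e::finite ^ 'e" and \<iota> :: "'k \<Rightarrow> 'r::comm_ring_1"
  assumes P: "weight_projections P" and \<iota>: "ring_map \<iota>" and L: "cart.subspace L"
  shows "torus_map (laurent_const \<circ> \<iota>) P laurent_var ` base_change laurent_const L = base_change laurent_const L
    \<longleftrightarrow> (\<forall>x\<in>L. \<forall>i<3. map_mat \<iota> (P i) *v x \<in> L)"
proof
  let ?c = "map_vec laurent_const"
  let ?T = "torus_map (laurent_const \<circ> \<iota>) P laurent_var"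
  have mat: "map_mat (laurent_const \<circ> \<iota>) A *v ?c x = ?c (map_mat \<iota> A *v x)" for A :: "'k ^ 'e ^ 'e" and x
    using map_mat_vec[OF ring_map_laurent_const, of "map_mat \<iota> A" x] by (simp add: map_mat_comp)
  have T: "?T (?c x) = (\<Sum>i<3. laurent_var ^ i *s ?c (map_mat \<iota> (P i) *v x))" for x
    by (simp add: torus_map_def mat)
  {
    assume eq: "?T ` base_change laurent_const L = base_change laurent_const L"
    show "\<forall>x\<in>L. \<forall>i<3. map_mat \<iota> (P i) *v x \<in> L"
    proof (intro ballI allI impI)
      fix x and i :: nat assume x: "x \<in> L" and i: "i < 3"
      have "?c x \<in> base_change laurent_const L"
        unfolding base_change_eq_span using x by (intro cart.span_base) auto
      then have "?T (?c x) \<in> base_change laurent_const L" using eq by blast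
      from laurent_coefficient_in_line[OF L this, of "int i"]
      have "(\<chi> e. Poly_Mapping.lookup (?T (?c x) $ e) (int i)) \<in> L" .
      moreover have "Poly_Mapping.lookup (?T (?c x) $ e) (int i) = (map_mat \<iota> (P i) *v x) $ e" for e
      proof -
        have "?T (?c x) $ e = (\<Sum>j<3. laurent_var ^ j * laurent_const ((map_mat \<iota> (P j) *v x) $ e))"
          unfolding T by (simp add: map_vec_def)
        then have "Poly_Mapping.lookup (?T (?c x) $ e) (int i) =
            (\<Sum>j<3. Poly_Mapping.lookup (laurent_var ^ j * laurent_const ((map_mat \<iota> (P j) *v x) $ e)) (int i))"
          by (simp only: lookup_sum)
        also have "\<dots> = (\<Sum>j<3. if j = i then (map_mat \<iota> (P i) *v x) $ e else 0)"
          by (intro sum.cong) (auto simp: lookup_mult_laurent_const laurent_var_power lookup_single when_def)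
        finally show ?thesis using i by simp
      qed
      ultimately show "map_mat \<iota> (P i) *v x \<in> L" by simp
    qed
  next
    assume closed: "\<forall>x\<in>L. \<forall>i<3. map_mat \<iota> (P i) *v x \<in> L"
    have lin: "module_hom (*s) (*s) (torus_map (laurent_const \<circ> \<iota>) P t)" for t
      by unfold_locales (auto simp: torus_map_add torus_map_scale)
    define s :: "int \<Rightarrow>\<^sub>0 'r" where "s = Poly_Mapping.single (- 1) 1"
    have ts: "laurent_var * s = 1"
      by (simp add: s_def laurent_var_def mult_single)
    have stable: "torus_map (laurent_const \<circ> \<iota>) P t ` base_change laurent_const L \<subseteq> base_change laurent_const L" for t
    proof -
      have "torus_map (laurent_const \<circ> \<iota>) P t ` (?c ` L) \<subseteq> base_change laurent_const L"
      proof clarify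
        fix x assume x: "x \<in> L"
        have "torus_map (laurent_const \<circ> \<iota>) P t (?c x) = (\<Sum>i<3. t ^ i *s ?c (map_mat \<iota> (P i) *v x))"
          by (simp add: torus_map_def mat)
        also have "\<dots> \<in> base_change laurent_const L"
          unfolding base_change_eq_span
          using closed x by (intro cart.span_sum cart.span_scale cart.span_base) auto
        finally show "torus_map (laurent_const \<circ> \<iota>) P t (?c x) \<in> base_change laurent_const L" .
      qed
      then show ?thesis
        unfolding base_change_eq_span module_hom.span_image[OF lin, symmetric]
        by (intro cart.span_minimal cart.subspace_span)
    qed
    have rm: "ring_map (laurent_const \<circ> \<iota>)"
      by (rule ring_map_comp[OF \<iota> ring_map_laurent_const])
    have "y \<in> ?T ` base_change laurent_const L" if y: "y \<in> base_change laurent_const L" for y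
    proof -
      have "?T (torus_map (laurent_const \<circ> \<iota>) P s y) = y"
        unfolding torus_map_mult[OF P rm, symmetric] ts torus_map_one[OF P rm] ..
      moreover have "torus_map (laurent_const \<circ> \<iota>) P s y \<in> base_change laurent_const L"
        using stable[of s] y by blast
      ultimately show ?thesis by (metis rev_image_eqI)
    qed
    then show "?T ` base_change laurent_const L = base_change laurent_const L"
      using stable[of laurent_var] by blast
  }
qed

text \<open>
  A line in two different weight spaces would be zero, but a line is faithful and \<open>1 \<noteq> 0\<close>.
\<close>

lemma proj_disjoint_weight_spaces:
  fixes P :: "nat \<Rightarrow> 'k::field ^ 'e::finite ^ 'e" and \<iota> :: "'k \<Rightarrow> 'r::comm_ring_1"
  assumes P: "weight_projections P" and \<iota>: "ring_map \<iota>"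
  shows "proj_disjoint \<iota> (weight_space P 0) (weight_space P 1) (weight_space P 2)"
proof -
  have "proj_subspace \<iota> (weight_space P i) \<inter> proj_subspace \<iota> (weight_space P j) = {}"
    if ij: "i < 3" "j < 3" "i \<noteq> j" for i j
  proof -
    have False if L: "L \<in> proj_subspace \<iota> (weight_space P i)" "L \<in> proj_subspace \<iota> (weight_space P j)" for L
    proof -
      have "x = 0" if "x \<in> L" for x
      proof -
        have "map_mat \<iota> (P i) *v x = x" "map_mat \<iota> (P j) *v x = x"
          using L[unfolded proj_subspace_def, THEN proj_points_subset] that ij
          by (auto simp: base_change_weight_space[OF P _ \<iota>])
        then show ?thesis using weight_components(2)[OF P \<iota> ij(1,2), of x] ij(3) by simp
      qed
      moreover have "locally_free_rank_one L"
        using L(1) by (simp add: proj_subspace_def proj_points_def)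
      ultimately have "(1 :: 'r) = 0"
        using locally_free_rank_one_faithful[of L 1] by simp
      then show False by simp
    qed
    then show ?thesis by blast
  qed
  then show ?thesis by (simp add: proj_disjoint_def)
qed

text \<open>
  The projections act on \<open>L\<close> by scalars. The relations between the projections carry over to the scalars
  because only \<open>0\<close> annihilates \<open>L\<close>.
\<close>

lemma fixed_line_idempotents:
  fixes P :: "nat \<Rightarrow> 'k::field ^ 'e::finite ^ 'e" and \<iota> :: "'k \<Rightarrow> 'r::comm_ring_1"
  assumes P: "weight_projections P" and \<iota>: "ring_map \<iota>" and L: "L \<in> proj_points UNIV"
    and stable: "\<forall>x\<in>L. \<forall>i<3. map_mat \<iota> (P i) *v x \<in> L"
  shows "L \<in> proj_union \<iota> (weight_space P 0) (weight_space P 1) (weight_space P 2)"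
proof -
  have "\<exists>a. \<forall>x\<in>L. map_mat \<iota> (P i) *v x = a *s x" if "i < 3" for i
    using endomorphism_of_line_is_scalar[OF L, of "map_mat \<iota> (P i)"] stable that by blast
  then obtain a where a: "\<And>i x. i < 3 \<Longrightarrow> x \<in> L \<Longrightarrow> map_mat \<iota> (P i) *v x = a i *s x" by metis
  have lf: "locally_free_rank_one L" using L by (simp add: proj_points_def)
  have "(a 0 + a 1 + a 2 - 1) *s x = 0" if "x \<in> L" for x
    using weight_components(1)[OF P \<iota>, of x] that
    by (simp add: sum_lessThan_3 a cart.scale_left_diff_distrib cart.scale_left_distrib)
  then have "a 0 + a 1 + a 2 - 1 = 0" by (rule locally_free_rank_one_faithful[OF lf])
  then have sum: "a 0 + a 1 + a 2 = 1" by simp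
  have orth: "a i * a j = 0" if ij: "i < 3" "j < 3" "i \<noteq> j" for i j
  proof (rule locally_free_rank_one_faithful[OF lf])
    fix x assume x: "x \<in> L"
    have "a j *s x \<in> L" using stable a x ij by metis
    then have "(a i * a j) *s x = map_mat \<iota> (P i) *v (map_mat \<iota> (P j) *v x)"
      using a ij x by simp
    then show "(a i * a j) *s x = 0"
      using weight_components(2)[OF P \<iota> ij(1,2), of x] ij(3) by simp
  qed
  have mem: "a i *s x \<in> base_change \<iota> (weight_space P i)" if "i < 3" "x \<in> L" for i x
    using weight_components(2)[OF P \<iota> that(1,1), of x]
    by (simp add: base_change_weight_space[OF P that(1) \<iota>] a[OF that])
  have "a 0 + a 1 + a 2 = 1 \<and> a 0 * a 1 = 0 \<and> a 0 * a 2 = 0 \<and> a 1 * a 2 = 0 \<and>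
      (\<forall>x\<in>L. a 0 *s x \<in> base_change \<iota> (weight_space P 0) \<and> a 1 *s x \<in> base_change \<iota> (weight_space P 1) \<and>
        a 2 *s x \<in> base_change \<iota> (weight_space P 2))"
    using sum orth mem by simp
  then show ?thesis unfolding proj_union_def using L by blast
qed

text \<open>
  Orthogonality and the sum \<open>1\<close> make the three scalars idempotent. Since \<open>x\<close> is the sum of the \<open>a i *s x\<close>, these
  are its components.
\<close>

lemma idempotents_stable_line:
  fixes P :: "nat \<Rightarrow> 'k::field ^ 'e::finite ^ 'e" and \<iota> :: "'k \<Rightarrow> 'r::comm_ring_1"
  assumes P: "weight_projections P" and \<iota>: "ring_map \<iota>"
    and "L \<in> proj_union \<iota> (weight_space P 0) (weight_space P 1) (weight_space P 2)"
  obtains a where "(\<Sum>i<3. a i) = 1" and "\<And>i. i < 3 \<Longrightarrow> a i * a i = a i"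
    and "\<And>i x. i < 3 \<Longrightarrow> x \<in> L \<Longrightarrow> a i *s x \<in> base_change \<iota> (weight_space P i)"
    and "\<And>i x. i < 3 \<Longrightarrow> x \<in> L \<Longrightarrow> map_mat \<iota> (P i) *v x = a i *s x"
proof -
  obtain b0 b1 b2 where b: "b0 + b1 + b2 = 1" "b0 * b1 = 0" "b0 * b2 = 0" "b1 * b2 = 0"
    and mem0: "\<forall>x\<in>L. b0 *s x \<in> base_change \<iota> (weight_space P 0) \<and> b1 *s x \<in> base_change \<iota> (weight_space P 1) \<and>
      b2 *s x \<in> base_change \<iota> (weight_space P 2)"
    using assms(3) unfolding proj_union_def by blast
  define a where "a i = (if i = 0 then b0 else if i = 1 then b1 else b2)" for i :: nat
  have sum: "(\<Sum>i<3. a i) = 1"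
    using b(1) by (simp add: sum_lessThan_3 a_def)
  have "b0 * b0 = b0 * (b0 + b1 + b2)" "b1 * b1 = b1 * (b0 + b1 + b2)" "b2 * b2 = b2 * (b0 + b1 + b2)"
    using b(2-4) by (simp_all add: distrib_left mult.commute)
  then have idem: "a i * a i = a i" if "i < 3" for i
    using that b(1) by (auto simp: a_def elim!: less_3_cases)
  have mem: "a i *s x \<in> base_change \<iota> (weight_space P i)" if "i < 3" "x \<in> L" for i x
    using that(1)
  proof (rule less_3_cases)
    show ?thesis if "i = 0" using mem0 \<open>x \<in> L\<close> that by (simp add: a_def)
    show ?thesis if "i = 1" using mem0 \<open>x \<in> L\<close> that by (simp add: a_def)
    show ?thesis if "i = 2" using mem0 \<open>x \<in> L\<close> that by (simp add: a_def)
  qed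
  have "map_mat \<iota> (P i) *v x = a i *s x" if i: "i < 3" and x: "x \<in> L" for i x
  proof -
    have self: "map_mat \<iota> (P j) *v (a j *s x) = a j *s x" if "j < 3" for j
      using mem[OF that x] by (simp add: base_change_weight_space[OF P that \<iota>])
    have "map_mat \<iota> (P i) *v (a j *s x) = (if j = i then a i *s x else 0)" if "j < 3" for j
      using weight_components(2)[OF P \<iota> i that, of "a j *s x"] self[OF that] by auto
    moreover have "x = (\<Sum>j<3. a j *s x)"
      using sum by (simp add: cart.scale_sum_left[symmetric])
    then have "map_mat \<iota> (P i) *v x = (\<Sum>j<3. map_mat \<iota> (P i) *v (a j *s x))"
      using matrix_vector_mult_sum_right by metis
    ultimately show ?thesis using i by simp
  qed
  with sum idem mem show thesis by (rule that)
qed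

section \<open>The Laplacian on the weight spaces\<close>

text \<open>
  Every index occurs once as a row and once as a column in each term of the expansion.
\<close>

lemma leibniz_det_scale:
  assumes "finite S"
  shows "leibniz_det S (\<lambda>i j. t ^ (d i + d j) * M i j) = t ^ (2 * sum d S) * leibniz_det S M"
proof -
  have "(\<Prod>i\<in>S. t ^ (d i + d (p i)) * M i (p i)) = t ^ (2 * sum d S) * (\<Prod>i\<in>S. M i (p i))"
    if "p permutes S" for p
  proof -
    have "(\<Sum>i\<in>S. d i + d (p i)) = 2 * sum d S"
      using sum.permute[OF that, of d] by (simp add: sum.distrib o_def)
    then show ?thesis by (simp add: prod.distrib power_sum[symmetric])
  qed
  then show ?thesis
    unfolding leibniz_det_def sum_distrib_left by (intro sum.cong) (auto simp: algebra_simps)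
qed

lemma leibniz_det_eq_0:
  assumes "finite S" and "\<And>p. p permutes S \<Longrightarrow> \<exists>i\<in>S. M i (p i) = 0"
  shows "leibniz_det S M = 0"
  unfolding leibniz_det_def
proof (intro sum.neutral ballI)
  fix p assume "p \<in> {p. p permutes S}"
  then have "(\<Prod>i\<in>S. M i (p i)) = 0" using assms by (intro prod_zero) auto
  then show "of_int (sign p) * (\<Prod>i\<in>S. M i (p i)) = 0" by simp
qed

lemma laplacian_sum:
  "laplacian ends A (\<lambda>e. \<Sum>k\<in>I. c k * x k e) i j = (\<Sum>k\<in>I. c k * laplacian ends A (x k) i j)"
  unfolding laplacian_def sum_distrib_left
  by (subst (2) sum.swap) (simp add: ac_simps)

lemma laplacian_scale: "laplacian ends A (\<lambda>e. c * x e) i j = c * laplacian ends A x i j"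
  unfolding laplacian_def sum_distrib_left by (simp add: ac_simps)

lemma laplacian_map_vec:
  assumes "ring_map \<iota>"
  shows "laplacian ends UNIV (($) (map_vec \<iota> v)) i j = \<iota> (laplacian ends UNIV (($) v) i j)"
  unfolding laplacian_def map_vec_def ring_map_simps(6)[OF assms]
  by (intro sum.cong) (auto simp: ring_map_simps[OF assms])

text \<open>
  An entry of the Laplacian is a linear form with integral coefficients, hence commutes with base
  change.
\<close>

lemma laplacian_vanishes_on_base_change:
  assumes \<iota>: "ring_map \<iota>" and V: "\<And>v. v \<in> A \<Longrightarrow> laplacian ends UNIV (($) v) i j = 0"
    and x: "x \<in> base_change \<iota> A"
  shows "laplacian ends UNIV (($) x) i j = 0"
proof -
  have "cart.subspace {x. laplacian ends UNIV (($) x) i j = 0}"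
    unfolding cart.subspace_def
    by (auto simp: laplacian_def distrib_left sum.distrib mult.left_commute simp flip: sum_distrib_left)
  then have "base_change \<iota> A \<subseteq> {x. laplacian ends UNIV (($) x) i j = 0}"
    unfolding base_change_eq_span
    by (intro cart.span_minimal) (auto simp: laplacian_map_vec[OF \<iota>] V ring_map_simps[OF \<iota>])
  then show ?thesis using x by blast
qed

text \<open>
  The matrix \<open>M\<close> stands for the Laplacian at a point of weight \<open>k\<close>. A permutation with nonzero factors
  throughout would have to exchange the two sides, which forces \<open>card N\<^sub>1 = card N\<^sub>2\<close>; so some vertex \<open>v\<close>
  is not adjacent to \<open>v\<^sub>0\<close>. But an edge from \<open>v\<close> to the other side would make it adjacent.
\<close>

lemma nexus_permutation_zero:
  assumes fat: "fat_nexus_partition Vs ends v\<^sub>0 N\<^sub>1 N\<^sub>2" and fin: "finite (N\<^sub>1 \<union> N\<^sub>2)"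
    and p: "p permutes (N\<^sub>1 \<union> N\<^sub>2)"
    and M: "\<And>i j. i \<in> N\<^sub>1 \<union> N\<^sub>2 \<Longrightarrow> j \<in> N\<^sub>1 \<union> N\<^sub>2 \<Longrightarrow> nexus_weight N\<^sub>1 i + nexus_weight N\<^sub>1 j \<noteq> k \<Longrightarrow> M i j = 0"
    and edge: "\<And>i j. i \<noteq> j \<Longrightarrow> \<nexists>e. ends e = {i, j} \<Longrightarrow> M i j = 0"
  shows "\<exists>i\<in>N\<^sub>1 \<union> N\<^sub>2. M i (p i) = 0"
proof (rule ccontr)
  assume "\<not> ?thesis"
  then have ne: "M i (p i) \<noteq> 0" if "i \<in> N\<^sub>1 \<union> N\<^sub>2" for i using that by blast
  have pS: "p i \<in> N\<^sub>1 \<union> N\<^sub>2" if "i \<in> N\<^sub>1 \<union> N\<^sub>2" for i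
    using that p by (simp only: permutes_in_image)
  have w: "nexus_weight N\<^sub>1 i + nexus_weight N\<^sub>1 (p i) = k" if "i \<in> N\<^sub>1 \<union> N\<^sub>2" for i
    using M[OF that pS[OF that]] ne[OF that] by blast
  have disj: "N\<^sub>1 \<inter> N\<^sub>2 = {}" and Vs: "Vs = insert v\<^sub>0 (N\<^sub>1 \<union> N\<^sub>2)" and v0: "v\<^sub>0 \<notin> N\<^sub>1 \<union> N\<^sub>2"
    using fat by (auto simp: fat_nexus_partition_def)
  obtain a b where a: "a \<in> N\<^sub>1" and b: "b \<in> N\<^sub>2"
    using fat by (auto simp: fat_nexus_partition_def)
  have "b \<notin> N\<^sub>1" using b disj by auto
  then have k: "k = 1"
    using w[of a] w[of b] a b by (auto simp: nexus_weight_def split: if_splits)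
  have swap: "p i \<in> N\<^sub>1 \<longleftrightarrow> i \<in> N\<^sub>2" if "i \<in> N\<^sub>1 \<union> N\<^sub>2" for i
    using w[OF that] that disj by (auto simp: nexus_weight_def k split: if_splits)
  have inj: "inj_on p A" for A by (rule inj_on_subset[OF permutes_inj[OF p] subset_UNIV])
  have "p ` N\<^sub>2 \<subseteq> N\<^sub>1" using swap by auto
  then have "card N\<^sub>2 \<le> card N\<^sub>1" using inj fin by (intro card_inj_on_le) auto
  moreover have "p ` N\<^sub>1 \<subseteq> N\<^sub>2"
  proof
    fix y assume "y \<in> p ` N\<^sub>1"
    then obtain i where "i \<in> N\<^sub>1" "y = p i" by blast
    then show "y \<in> N\<^sub>2" using swap[of i] pS[of i] disj by blast
  qed
  then have "card N\<^sub>1 \<le> card N\<^sub>2" using inj fin by (intro card_inj_on_le) auto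
  ultimately have "\<not> is_cone Vs ends v\<^sub>0"
    using fat by (auto simp: fat_nexus_partition_def)
  moreover have "nbhd Vs ends v\<^sub>0 \<subseteq> Vs" using Vs by (auto simp: nbhd_def)
  ultimately obtain v where v: "v \<in> Vs" "v \<notin> nbhd Vs ends v\<^sub>0"
    unfolding is_cone_def by blast
  then have vS: "v \<in> N\<^sub>1 \<union> N\<^sub>2" using Vs by (auto simp: nbhd_def)
  have sides: "v \<in> N\<^sub>1 \<and> p v \<in> N\<^sub>2 \<or> v \<in> N\<^sub>2 \<and> p v \<in> N\<^sub>1"
    using swap[OF vS] pS[OF vS] vS disj by blast
  then have "v \<noteq> p v" using disj by auto
  then obtain e where e: "ends e = {v, p v}" using edge ne[OF vS] by blast
  then have "ends e \<inter> N\<^sub>1 \<noteq> {}" "ends e \<inter> N\<^sub>2 \<noteq> {}" using sides by auto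
  then have "ends e \<subseteq> nbhd Vs ends v\<^sub>0" using fat unfolding fat_nexus_partition_def by blast
  then show False using e v(2) by auto
qed

section \<open>The torus action on the graph hypersurface\<close>

theorem theorem6p3:
  fixes Vs N\<^sub>1 N\<^sub>2 :: "'v set" and v\<^sub>0 :: 'v
    and ends :: "'e::finite \<Rightarrow> 'v set" and src tgt :: "'e \<Rightarrow> 'v"
    and V\<^sub>1 V\<^sub>2 V\<^sub>3 :: "('k::field ^ 'e) set"
    and \<iota> :: "'k \<Rightarrow> 'r::comm_ring_1" and \<phi> :: "'r \<Rightarrow> 's::comm_ring_1"
  assumes "simple_graph Vs ends"
    and "connected_graph Vs ends"
    and "fat_nexus_partition Vs ends v\<^sub>0 N\<^sub>1 N\<^sub>2"
    and "orientation ends src tgt"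
    and "nexus_decomposition src tgt Vs N\<^sub>1 N\<^sub>2 V\<^sub>1 V\<^sub>2 V\<^sub>3"
    and "ring_map \<iota>" and "ring_map \<phi>"
  shows "gm_acts_on \<iota> V\<^sub>1 V\<^sub>2 V\<^sub>3 (graph_hypersurface Vs ends \<iota>) \<and>
    gm_act_natural \<phi> \<iota> V\<^sub>1 V\<^sub>2 V\<^sub>3 (graph_hypersurface Vs ends \<iota>) \<and>
    gm_fixed_points \<iota> V\<^sub>1 V\<^sub>2 V\<^sub>3 (graph_hypersurface Vs ends \<iota>) = proj_union \<iota> V\<^sub>1 V\<^sub>2 V\<^sub>3 \<and>
    proj_disjoint \<iota> V\<^sub>1 V\<^sub>2 V\<^sub>3"
proof -
  note simple = assms(1) and fat = assms(3) and or = assms(4) and dec = assms(5) and \<iota> = assms(6) and \<phi> = assms(7)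
  obtain P where P: "weight_projections P"
    and V: "V\<^sub>1 = weight_space P 0" "V\<^sub>2 = weight_space P 1" "V\<^sub>3 = weight_space P 2"
    and lap_k: "\<And>k x i j. k < 3 \<Longrightarrow> x \<in> weight_space P k \<Longrightarrow> i \<in> N\<^sub>1 \<union> N\<^sub>2 \<Longrightarrow> j \<in> N\<^sub>1 \<union> N\<^sub>2 \<Longrightarrow>
      nexus_weight N\<^sub>1 i + nexus_weight N\<^sub>1 j \<noteq> k \<Longrightarrow> laplacian ends UNIV (($) x) i j = 0"
    using nexus_weight_projections[OF simple fat or dec] by blast
  define S where "S = N\<^sub>1 \<union> N\<^sub>2"
  define d where "d = nexus_weight N\<^sub>1"
  have S: "S = Vs - {v\<^sub>0}" and v0: "v\<^sub>0 \<in> Vs" and S_ne: "S \<noteq> {}"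
    using fat by (auto simp: fat_nexus_partition_def S_def)
  have fin: "finite S" using simple by (simp add: S simple_graph_def)
  let ?lap = "\<lambda>x :: 'r ^ 'e. laplacian ends UNIV (($) x)"
  let ?X = "graph_hypersurface Vs ends \<iota>"
  define \<psi> where "\<psi> x = eval_poly \<iota> (graph_polynomial Vs ends) x" for x :: "'r ^ 'e"
  have \<psi>: "\<psi> x = leibniz_det S (?lap x)" for x
    unfolding \<psi>_def S by (rule eval_graph_polynomial_eq_det[OF \<iota> simple v0])
  have X: "?X = {L \<in> proj_points UNIV. \<forall>x\<in>L. \<psi> x = 0}"
    by (simp add: graph_hypersurface_def proj_zero_locus_def \<psi>_def)
  have lap_zero: "?lap x i j = 0"
    if "k < 3" "x \<in> base_change \<iota> (weight_space P k)" "i \<in> S" "j \<in> S" "d i + d j \<noteq> k" for k x i j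
    using lap_k[OF that(1)] that(3-5) unfolding S_def d_def
    by (intro laplacian_vanishes_on_base_change[OF \<iota> _ that(2)]) blast
  have lap_torus: "?lap (torus_map \<iota> P t x) i j = t ^ (d i + d j) * ?lap x i j"
    if ij: "i \<in> S" "j \<in> S" for t x i j
  proof -
    let ?Q = "\<lambda>k. map_mat \<iota> (P k) *v x"
    \<comment> \<open>Only the component of weight \<open>d i + d j\<close> contributes to this entry.\<close>
    have expand: "?lap (torus_map \<iota> P t x) i j = t ^ (d i + d j) * ?lap (?Q (d i + d j)) i j" for t
    proof -
      have "($) (torus_map \<iota> P t x) = (\<lambda>e. \<Sum>k<3. t ^ k * ?Q k $ e)"
        by (simp add: torus_map_def fun_eq_iff)
      then have "?lap (torus_map \<iota> P t x) i j = (\<Sum>k<3. t ^ k * ?lap (?Q k) i j)"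
        by (simp only: laplacian_sum)
      also have "\<dots> = (\<Sum>k<3. if k = d i + d j then t ^ (d i + d j) * ?lap (?Q (d i + d j)) i j else 0)"
      proof (rule sum.cong)
        fix k :: nat assume "k \<in> {..<3}"
        then have k: "k < 3" by simp
        have "?Q k \<in> base_change \<iota> (weight_space P k)"
          using weight_components(2)[OF P \<iota> k k, of x] by (simp add: base_change_weight_space[OF P k \<iota>])
        from lap_zero[OF k this ij]
        show "t ^ k * ?lap (?Q k) i j = (if k = d i + d j then t ^ (d i + d j) * ?lap (?Q (d i + d j)) i j else 0)"
          by (cases "k = d i + d j") auto
      qed simp
      also have "\<dots> = t ^ (d i + d j) * ?lap (?Q (d i + d j)) i j"
        by (simp add: d_def nexus_weight_def)
      finally show ?thesis .
    qed
    have "?lap x i j = ?lap (?Q (d i + d j)) i j"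
      using expand[of 1] by (simp add: torus_map_one[OF P \<iota>])
    then show ?thesis using expand[of t] by simp
  qed
  have \<psi>_torus: "\<psi> (torus_map \<iota> P t x) = t ^ (2 * sum d S) * \<psi> x" for t x
    unfolding \<psi> leibniz_det_scale[OF fin, symmetric]
    by (rule leibniz_det_cong) (rule lap_torus)
  have \<psi>_scale: "\<psi> (c *s x) = c ^ card S * \<psi> x" for c x
  proof -
    have "($) (c *s x) = (\<lambda>e. c * x $ e)" by (simp add: fun_eq_iff)
    then have "?lap (c *s x) = (\<lambda>i j. c * ?lap x i j)"
      by (intro ext) (simp only: laplacian_scale)
    then show ?thesis
      by (simp add: \<psi> leibniz_det_def prod.distrib sum_distrib_left mult.left_commute)
  qed
  have \<psi>_zero: "\<psi> x = 0" if k: "k < 3" and x: "x \<in> base_change \<iota> (weight_space P k)" for k x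
    unfolding \<psi>
  proof (rule leibniz_det_eq_0[OF fin])
    fix p assume "p permutes S"
    then show "\<exists>i\<in>S. ?lap x i (p i) = 0"
      unfolding S_def
    proof (rule nexus_permutation_zero[OF fat fin[unfolded S_def]])
      show "?lap x i j = 0" if "i \<in> N\<^sub>1 \<union> N\<^sub>2" "j \<in> N\<^sub>1 \<union> N\<^sub>2" "nexus_weight N\<^sub>1 i + nexus_weight N\<^sub>1 j \<noteq> k" for i j
        using lap_zero[OF k x] that unfolding S_def d_def by blast
      show "?lap x i j = 0" if "i \<noteq> j" "\<nexists>e. ends e = {i, j}" for i j
        unfolding laplacian_def using that by (intro sum.neutral) auto
    qed
  qed
  have act: "gm_act \<iota> V\<^sub>1 V\<^sub>2 V\<^sub>3 t L = torus_map \<iota> P t ` L" for t and L :: "('r ^ 'e) set"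
    unfolding V by (rule gm_act_eq_image[OF P \<iota>])
  have rm_comp: "ring_map (\<phi> \<circ> \<iota>)" "ring_map (laurent_const \<circ> \<iota>)"
    by (rule ring_map_comp[OF \<iota> \<phi>], rule ring_map_comp[OF \<iota> ring_map_laurent_const])
  have "torus_map \<iota> P t ` L \<in> ?X" if t: "t dvd 1" and L: "L \<in> ?X" for t L
  proof -
    obtain s where st: "s * t = 1" "t * s = 1" using t by (metis dvdE mult.commute)
    have "torus_map \<iota> P t ` L \<in> proj_points UNIV"
    proof (rule proj_points_image[where g = "torus_map \<iota> P s"])
      show "torus_map \<iota> P s (torus_map \<iota> P t x) = x" "torus_map \<iota> P t (torus_map \<iota> P s x) = x" for x
        unfolding torus_map_mult[OF P \<iota>, symmetric] st by (rule torus_map_one[OF P \<iota>])+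
    qed (use L X in \<open>auto simp: torus_map_add torus_map_scale\<close>)
    then show ?thesis using L unfolding X by (auto simp: \<psi>_torus)
  qed
  then have acts: "gm_acts_on \<iota> V\<^sub>1 V\<^sub>2 V\<^sub>3 ?X"
    unfolding gm_acts_on_def act by (auto simp: torus_map_one[OF P \<iota>] torus_map_mult[OF P \<iota>] image_image)
  have natural: "gm_act_natural \<phi> \<iota> V\<^sub>1 V\<^sub>2 V\<^sub>3 ?X"
    unfolding gm_act_natural_def V gm_act_eq_image[OF P \<iota>] gm_act_eq_image[OF P rm_comp(1)]
    by (simp add: base_change_torus_image[OF \<iota> \<phi>])
  have fixed_iff: "L \<in> gm_fixed_points \<iota> V\<^sub>1 V\<^sub>2 V\<^sub>3 ?X \<longleftrightarrow> L \<in> ?X \<and> (\<forall>x\<in>L. \<forall>i<3. map_mat \<iota> (P i) *v x \<in> L)" for L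
  proof -
    have "cart.subspace L" if "L \<in> ?X"
      using that proj_points_subspace unfolding X by blast
    then show ?thesis
      unfolding gm_fixed_points_def V gm_act_eq_image[OF P rm_comp(2)]
      using torus_fixed_line_iff[OF P \<iota>, of L] by blast
  qed
  have "gm_fixed_points \<iota> V\<^sub>1 V\<^sub>2 V\<^sub>3 ?X = proj_union \<iota> V\<^sub>1 V\<^sub>2 V\<^sub>3"
  proof (intro set_eqI iffI)
    fix L assume "L \<in> gm_fixed_points \<iota> V\<^sub>1 V\<^sub>2 V\<^sub>3 ?X"
    then have "L \<in> proj_points UNIV" "\<forall>x\<in>L. \<forall>i<3. map_mat \<iota> (P i) *v x \<in> L"
      unfolding fixed_iff unfolding X by blast+
    then show "L \<in> proj_union \<iota> V\<^sub>1 V\<^sub>2 V\<^sub>3"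
      unfolding V by (rule fixed_line_idempotents[OF P \<iota>])
  next
    fix L assume L: "L \<in> proj_union \<iota> V\<^sub>1 V\<^sub>2 V\<^sub>3"
    then have Lp: "L \<in> proj_points UNIV" by (simp add: proj_union_def)
    obtain a where a: "(\<Sum>i<3. a i) = 1" "\<And>i. i < 3 \<Longrightarrow> a i * a i = a i"
      "\<And>i x. i < 3 \<Longrightarrow> x \<in> L \<Longrightarrow> a i *s x \<in> base_change \<iota> (weight_space P i)"
      "\<And>i x. i < 3 \<Longrightarrow> x \<in> L \<Longrightarrow> map_mat \<iota> (P i) *v x = a i *s x"
      using idempotents_stable_line[OF P \<iota> L[unfolded V]] by blast
    have "\<psi> x = 0" if x: "x \<in> L" for x
    proof -
      \<comment> \<open>The scalar \<open>a i\<close> equals its positive powers, so that it can be moved inside the form.\<close>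
      have "a i * \<psi> x = 0" if i: "i < 3" for i
      proof -
        have pow: "a i ^ Suc n = a i" for n
          by (induction n) (simp_all add: a(2)[OF i])
        have "card S > 0" using S_ne fin by (simp add: card_gt_0_iff)
        then have "a i ^ card S = a i" using pow[of "card S - 1"] by simp
        then have "a i * \<psi> x = \<psi> (a i *s x)" by (simp add: \<psi>_scale)
        also have "\<dots> = 0" using \<psi>_zero[OF i a(3)[OF i x]] .
        finally show ?thesis .
      qed
      then have "(\<Sum>i<3. a i) * \<psi> x = 0" unfolding sum_distrib_right by (intro sum.neutral) auto
      then show ?thesis by (simp add: a(1))
    qed
    moreover have "map_mat \<iota> (P i) *v x \<in> L" if "x \<in> L" "i < 3" for x i
      using cart.subspace_scale[OF proj_points_subspace[OF Lp] that(1)] a(4)[OF that(2,1)] by simp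
    ultimately show "L \<in> gm_fixed_points \<iota> V\<^sub>1 V\<^sub>2 V\<^sub>3 ?X"
      unfolding fixed_iff unfolding X using Lp by blast
  qed
  moreover have "proj_disjoint \<iota> V\<^sub>1 V\<^sub>2 V\<^sub>3"
    unfolding V by (rule proj_disjoint_weight_spaces[OF P \<iota>])
  ultimately show ?thesis using acts natural by blast
qed

end
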